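(* Let $R=K[x_1,\ldots,x_n]$ be a polynomial ring over a field $K$, let $I\subset R$ be a normally torsion-free square-free monomial ideal, and let $h$ be a square-free monomial in $R$. Suppose there exist two variables $x_r,x_s$ with $1\leq r\neq s\leq n$ such that for every $u\in\mathcal{G}(I)$ one has $\gcd(h,u)=1$, or $\gcd(h,u)=x_r$, or $\gcd(h,u)=x_rx_s$. Then the ideal $I+hR$ is normally torsion-free, nearly normally torsion-free, normal, has the strong persistence property, has the persistence property, and has the symbolic strong persistence property.
   Context: $\mathcal{G}(I)$ denotes the unique minimal monomial generating set of a monomial ideal $I$. $\mathrm{Ass}(R/I)$ is the set of associated primes and $\mathrm{Min}(I)$ the set of minimal primes of $I$. An ideal $I$ is normally torsion-free if $\mathrm{Ass}(R/I^k)\subseteq\mathrm{Ass}(R/I)$ for all $k\geq1$. A monomial ideal $I$ is nearly normally torsion-free if there exist a positive integer $k$ and a monomial prime ideal $\mathfrak p$ such that $\mathrm{Ass}(R/I^m)=\mathrm{Min}(I)$ for all $1\leq m\leq k$ and $\mathrm{Ass}(R/I^m)\subseteq\mathrm{Min}(I)\cup\{\mathfrak p\}$ for all $m\geq k+1$. $I$ is normal if $\overline{I^k}=I^k$ for all $k\geq1$, where $\overline{J}$ is the integral closure of $J$. $I$ has the strong persistence property if $(I^{k+1}:I)=I^k$ for all $k\geq1$; the persistence property if $\mathrm{Ass}(R/I^k)\subseteq\mathrm{Ass}(R/I^{k+1})$ for all $k\geq1$; and the symbolic strong persistence property if $(I^{(k+1)}:I^{(1)})=I^{(k)}$ for all $k\geq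 1$, where $I^{(k)}$ is the $k$-th symbolic power (intersection of the primary components of $I^k$ belonging to the minimal primes of $I$). *)

theory Defs
  imports Main "HOL-Library.Poly_Mapping"
begin

definition is_ideal :: "'a::comm_ring_1 set \<Rightarrow> bool" where
  "is_ideal I \<longleftrightarrow> 0 \<in> I \<and> (\<forall>a\<in>I. \<forall>b\<in>I. a + b \<in> I) \<and> (\<forall>a\<in>I. \<forall>r. r * a \<in> I)"

definition ideal_gen :: "'a::comm_ring_1 set \<Rightarrow> 'a set" where
  "ideal_gen S = \<Inter>{I. is_ideal I \<and> S \<subseteq> I}"

definition ideal_sum :: "'a::comm_ring_1 set \<Rightarrow> 'a set \<Rightarrow> 'a set" where
  "ideal_sum I J = ideal_gen (I \<union> J)"

definition ideal_prod :: "'a::comm_ring_1 set \<Rightarrow> 'a set \<Rightarrow> 'a set" where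
  "ideal_prod I J = ideal_gen {a * b | a b. a \<in> I \<and> b \<in> J}"

fun ideal_pow :: "'a::comm_ring_1 set \<Rightarrow> nat \<Rightarrow> 'a set" where
  "ideal_pow I 0 = UNIV"
| "ideal_pow I (Suc k) = ideal_prod (ideal_pow I k) I"

definition ideal_colon :: "'a::comm_ring_1 set \<Rightarrow> 'a set \<Rightarrow> 'a set" where
  "ideal_colon J I = {f. \<forall>g\<in>I. f * g \<in> J}"

definition prime_ideal :: "'a::comm_ring_1 set \<Rightarrow> bool" where
  "prime_ideal P \<longleftrightarrow> is_ideal P \<and> P \<noteq> UNIV \<and> (\<forall>a b. a * b \<in> P \<longrightarrow> a \<in> P \<or> b \<in> P)"

definition primary_ideal :: "'a::comm_ring_1 set \<Rightarrow> bool" where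
  "primary_ideal Q \<longleftrightarrow> is_ideal Q \<and> Q \<noteq> UNIV \<and>
     (\<forall>a b. a * b \<in> Q \<longrightarrow> a \<in> Q \<or> (\<exists>m. b ^ m \<in> Q))"

definition ideal_radical :: "'a::comm_ring_1 set \<Rightarrow> 'a set" where
  "ideal_radical I = {f. \<exists>m. f ^ m \<in> I}"

definition Ass :: "'a::comm_ring_1 set \<Rightarrow> 'a set set" where
  "Ass I = {P. prime_ideal P \<and> (\<exists>f. P = ideal_colon I {f})}"

definition Min_primes :: "'a::comm_ring_1 set \<Rightarrow> 'a set set" where
  "Min_primes I = {P. prime_ideal P \<and> I \<subseteq> P \<and>
     (\<forall>Q. prime_ideal Q \<and> I \<subseteq> Q \<and> Q \<subseteq> P \<longrightarrow> Q = P)}"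

definition integral_closure :: "'a::comm_ring_1 set \<Rightarrow> 'a set" where
  "integral_closure J = {f. \<exists>m\<ge>1. \<exists>a. (\<forall>i\<in>{1..m}. a i \<in> ideal_pow J i) \<and>
       f ^ m + (\<Sum>i=1..m. a i * f ^ (m - i)) = 0}"

definition symbolic_power :: "'a::comm_ring_1 set \<Rightarrow> nat \<Rightarrow> 'a set" where
  "symbolic_power I k = (SOME J. \<exists>Qs. finite Qs \<and> (\<forall>Q\<in>Qs. primary_ideal Q) \<and>
      ideal_pow I k = \<Inter>Qs \<and> J = \<Inter>{Q\<in>Qs. ideal_radical Q \<in> Min_primes I})"

definition is_gcd :: "'a::comm_ring_1 \<Rightarrow> 'a \<Rightarrow> 'a \<Rightarrow> bool" where
  "is_gcd g a b \<longleftrightarrow> g dvd a \<and> g dvd b \<and> (\<forall>d. d dvd a \<and> d dvd b \<longrightarrow> d dvd g)"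

definition normally_torsion_free :: "'a::comm_ring_1 set \<Rightarrow> bool" where
  "normally_torsion_free I \<longleftrightarrow> (\<forall>k\<ge>1. Ass (ideal_pow I k) \<subseteq> Ass I)"

definition normal_ideal :: "'a::comm_ring_1 set \<Rightarrow> bool" where
  "normal_ideal I \<longleftrightarrow> (\<forall>k\<ge>1. integral_closure (ideal_pow I k) = ideal_pow I k)"

definition strong_persistence :: "'a::comm_ring_1 set \<Rightarrow> bool" where
  "strong_persistence I \<longleftrightarrow> (\<forall>k\<ge>1. ideal_colon (ideal_pow I (k+1)) I = ideal_pow I k)"

definition persistence :: "'a::comm_ring_1 set \<Rightarrow> bool" where
  "persistence I \<longleftrightarrow> (\<forall>k\<ge>1. Ass (ideal_pow I k) \<subseteq> Ass (ideal_pow I (k+1)))"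

definition symbolic_strong_persistence :: "'a::comm_ring_1 set \<Rightarrow> bool" where
  "symbolic_strong_persistence I \<longleftrightarrow>
     (\<forall>k\<ge>1. ideal_colon (symbolic_power I (k+1)) (symbolic_power I 1) = symbolic_power I k)"

text \<open>The polynomial ring over a field \<open>'k\<close> in the finitely many variables indexed by
  \<open>'v\<close> is \<open>('v \<Rightarrow>\<^sub>0 nat) \<Rightarrow>\<^sub>0 'k\<close>; exponent vectors are \<open>'v \<Rightarrow>\<^sub>0 nat\<close>.\<close>

definition monom :: "('v \<Rightarrow>\<^sub>0 nat) \<Rightarrow> ('v \<Rightarrow>\<^sub>0 nat) \<Rightarrow>\<^sub>0 'k::field" where
  "monom a = Poly_Mapping.single a 1"

definition var :: "'v \<Rightarrow> ('v \<Rightarrow>\<^sub>0 nat) \<Rightarrow>\<^sub>0 'k::field" where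
  "var i = monom (Poly_Mapping.single i 1)"

definition squarefree_exp :: "('v \<Rightarrow>\<^sub>0 nat) \<Rightarrow> bool" where
  "squarefree_exp a \<longleftrightarrow> (\<forall>i. Poly_Mapping.lookup a i \<le> 1)"

definition squarefree_monomial :: "(('v \<Rightarrow>\<^sub>0 nat) \<Rightarrow>\<^sub>0 'k::field) \<Rightarrow> bool" where
  "squarefree_monomial h \<longleftrightarrow> (\<exists>a. squarefree_exp a \<and> h = monom a)"

definition squarefree_monomial_ideal :: "(('v \<Rightarrow>\<^sub>0 nat) \<Rightarrow>\<^sub>0 'k::field) set \<Rightarrow> bool" where
  "squarefree_monomial_ideal I \<longleftrightarrow>
     (\<exists>S. S \<subseteq> {h. squarefree_monomial h} \<and> I = ideal_gen S)"

text \<open>\<open>\<G>(I)\<close>: the monomials of \<open>I\<close> minimal with respect to divisibility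
  (the unique minimal monomial generating set of a monomial ideal).\<close>
definition min_gens :: "(('v \<Rightarrow>\<^sub>0 nat) \<Rightarrow>\<^sub>0 'k::field) set \<Rightarrow> (('v \<Rightarrow>\<^sub>0 nat) \<Rightarrow>\<^sub>0 'k) set" where
  "min_gens I = {monom a | a. monom a \<in> I \<and>
      (\<forall>b. monom b \<in> I \<and> (monom b :: ('v \<Rightarrow>\<^sub>0 nat) \<Rightarrow>\<^sub>0 'k) dvd monom a \<longrightarrow> b = a)}"

definition monomial_prime :: "(('v \<Rightarrow>\<^sub>0 nat) \<Rightarrow>\<^sub>0 'k::field) set \<Rightarrow> bool" where
  "monomial_prime P \<longleftrightarrow> (\<exists>S. P = ideal_gen (var ` S))"

definition nearly_normally_torsion_free :: "(('v \<Rightarrow>\<^sub>0 nat) \<Rightarrow>\<^sub>0 'k::field) set \<Rightarrow> bool" where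
  "nearly_normally_torsion_free I \<longleftrightarrow>
     (\<exists>k\<ge>1. \<exists>p. monomial_prime p \<and>
        (\<forall>m. 1 \<le> m \<and> m \<le> k \<longrightarrow> Ass (ideal_pow I m) = Min_primes I) \<and>
        (\<forall>m\<ge>k+1. Ass (ideal_pow I m) \<subseteq> Min_primes I \<union> {p}))"

end

theory Submission
  imports Defs
begin

text \<open>Regard the supports of the minimal generators of \<open>I\<close> as the edges of a hypergraph \<open>H\<close>. The ideal
  \<open>I\<close> is normally torsion-free iff \<open>I\<^sup>k\<close> is, for every \<open>k\<close>, the intersection of the powers \<open>P\<^sub>C\<^sup>k\<close> over
  the minimal vertex covers \<open>C\<close> of \<open>H\<close>, where \<open>P\<^sub>C\<close> is generated by the variables in \<open>C\<close>; in terms of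
  exponents this is a packing statement for weights on the vertices. The gcd condition forces
  \<open>\<bar>C \<inter> h\<bar> \<le> 1\<close> for every minimal cover \<open>C\<close> of the hypergraph enlarged by the support of \<open>h\<close>, and so
  the packing statement survives adding this edge. All the asserted properties follow from the
  resulting decomposition of the powers of \<open>I + hR\<close>, because the \<open>P\<^sub>C\<close>-adic order of a polynomial is
  a valuation.\<close>

section \<open>Powers of monomial primes and their valuations\<close>

abbreviation lookup where "lookup \<equiv> Poly_Mapping.lookup"
abbreviation keys where "keys \<equiv> Poly_Mapping.keys"

text \<open>Lexicographically least elements of \<open>A\<close> and \<open>B\<close> have this
  property. The induction on the coordinates builds them without fixing a variable order: restrict
  both sets to the least value at \<open>x\<close>, which any pair with the same sum must also
  attain, then recurse.\<close>

lemma unique_sum_on: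
  fixes A B :: "('v \<Rightarrow>\<^sub>0 nat) set"
  assumes "finite X" "finite A" "finite B" "A \<noteq> {}" "B \<noteq> {}"
  shows "\<exists>a\<in>A. \<exists>b\<in>B. \<forall>a'\<in>A. \<forall>b'\<in>B. a' + b' = a + b \<longrightarrow>
    (\<forall>x\<in>X. lookup a' x = lookup a x \<and> lookup b' x = lookup b x)"
  using assms
proof (induction X arbitrary: A B rule: finite_induct)
  case empty
  then show ?case by blast
next
  case (insert x X)
  define A' where "A' = {a\<in>A. \<forall>c\<in>A. lookup a x \<le> lookup c x}"
  define B' where "B' = {b\<in>B. \<forall>c\<in>B. lookup b x \<le> lookup c x}"
  obtain a0 where a0: "a0 \<in> A" "\<And>c. c \<in> A \<Longrightarrow> lookup a0 x \<le> lookup c x"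
    using ex_has_least_nat[of "\<lambda>a. a \<in> A" _ "\<lambda>a. lookup a x"] insert.prems by blast
  obtain b0 where b0: "b0 \<in> B" "\<And>c. c \<in> B \<Longrightarrow> lookup b0 x \<le> lookup c x"
    using ex_has_least_nat[of "\<lambda>a. a \<in> B" _ "\<lambda>a. lookup a x"] insert.prems by blast
  have "finite A'" "finite B'" "A' \<noteq> {}" "B' \<noteq> {}"
    using insert.prems a0 b0 by (auto simp: A'_def B'_def)
  from insert.IH[OF this] obtain a b where ab: "a \<in> A'" "b \<in> B'"
    and uniq: "\<And>a' b'. a' \<in> A' \<Longrightarrow> b' \<in> B' \<Longrightarrow> a' + b' = a + b \<Longrightarrow>
      (\<forall>x\<in>X. lookup a' x = lookup a x \<and> lookup b' x = lookup b x)"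
    by blast
  have "lookup a' y = lookup a y \<and> lookup b' y = lookup b y"
    if *: "a' \<in> A" "b' \<in> B" "a' + b' = a + b" "y \<in> insert x X" for a' b' y
  proof -
    have "lookup a' x + lookup b' x = lookup a x + lookup b x"
      using *(3) by (metis lookup_add)
    moreover have "lookup a x \<le> lookup a' x" "lookup b x \<le> lookup b' x"
      using ab * by (auto simp: A'_def B'_def)
    ultimately have eq: "lookup a' x = lookup a x" "lookup b' x = lookup b x"
      by auto
    then have "a' \<in> A'" "b' \<in> B'"
      using ab * by (auto simp: A'_def B'_def)
    then show ?thesis
      using uniq *(3,4) eq by blast
  qed
  moreover have "a \<in> A" "b \<in> B" using ab by (auto simp: A'_def B'_def)
  ultimately show ?case by blast
qed

lemma unique_sum:
  fixes A B :: "('v::finite \<Rightarrow>\<^sub>0 nat) set"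
  assumes "finite A" "finite B" "A \<noteq> {}" "B \<noteq> {}"
  obtains a b where "a \<in> A" "b \<in> B"
    "\<And>a' b'. a' \<in> A \<Longrightarrow> b' \<in> B \<Longrightarrow> a' + b' = a + b \<Longrightarrow> a' = a \<and> b' = b"
proof -
  obtain a b where ab: "a \<in> A" "b \<in> B" and uniq: "\<And>a' b'. a' \<in> A \<Longrightarrow> b' \<in> B \<Longrightarrow> a' + b' = a + b \<Longrightarrow>
      (\<forall>x\<in>UNIV. lookup a' x = lookup a x \<and> lookup b' x = lookup b x)"
    using unique_sum_on[of UNIV A B, OF finite assms] by blast
  show thesis
  proof (rule that[OF ab])
    show "a' = a \<and> b' = b" if "a' \<in> A" "b' \<in> B" "a' + b' = a + b" for a' b'
      using uniq[OF that] by (simp add: poly_mapping_eq_iff fun_eq_iff)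
  qed
qed

text \<open>An exponent of the product that comes from a single pair of terms cannot be cancelled,
  since its convolution sum has only one summand.\<close>

lemma lookup_mult_unique:
  fixes f g :: "'a::monoid_add \<Rightarrow>\<^sub>0 'k::semiring_0"
  assumes uniq: "\<And>a' b'. a' \<in> keys f \<Longrightarrow> b' \<in> keys g \<Longrightarrow> a' + b' = a + b \<Longrightarrow> a' = a \<and> b' = b"
  shows "lookup (f * g) (a + b) = lookup f a * lookup g b"
proof -
  have "lookup f l * (\<Sum>q. lookup g q when a + b = l + q) = (lookup f a * lookup g b when l = a)" for l
  proof (cases "l \<in> keys f")
    case True
    have "(lookup g q when a + b = l + q) = (lookup g b when (q = b \<and> l = a))" for q
      using uniq[OF True, of q] by (cases "q \<in> keys g") (auto simp: when_def in_keys_iff)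
    then show ?thesis
      by (cases "l = a") auto
  next
    case False
    then show ?thesis by (auto simp: in_keys_iff when_def)
  qed
  then show ?thesis
    by (simp add: lookup_mult)
qed

section \<open>Monomial ideals and the order of a polynomial along a set of variables\<close>

definition deg_on :: "'v set \<Rightarrow> ('v \<Rightarrow>\<^sub>0 nat) \<Rightarrow> nat" where
  "deg_on C a = (\<Sum>i\<in>C. lookup a i)"

lemma deg_on_add [simp]: "deg_on C (a + b) = deg_on C a + deg_on C b"
  by (simp add: deg_on_def lookup_add sum.distrib)

lemma deg_on_0 [simp]: "deg_on C 0 = 0"
  by (simp add: deg_on_def)

definition mon_ideal :: "('v \<Rightarrow>\<^sub>0 nat) set \<Rightarrow> (('v \<Rightarrow>\<^sub>0 nat) \<Rightarrow>\<^sub>0 'k::field) set" where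
  "mon_ideal A = {f. keys f \<subseteq> A}"

definition up_closed :: "('v \<Rightarrow>\<^sub>0 nat) set \<Rightarrow> bool" where
  "up_closed A \<longleftrightarrow> (\<forall>a\<in>A. \<forall>b. a + b \<in> A)"

text \<open>The \<open>k\<close>-th power of the prime ideal generated by the variables in \<open>C\<close>.\<close>
definition var_pow :: "'v set \<Rightarrow> nat \<Rightarrow> (('v \<Rightarrow>\<^sub>0 nat) \<Rightarrow>\<^sub>0 'k::field) set" where
  "var_pow C k = mon_ideal {a. k \<le> deg_on C a}"

lemma is_ideal_mon_ideal:
  assumes "up_closed A"
  shows "is_ideal (mon_ideal A :: (('v \<Rightarrow>\<^sub>0 nat) \<Rightarrow>\<^sub>0 'k::field) set)"
  unfolding is_ideal_def mon_ideal_def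
proof (intro conjI ballI allI)
  fix f g :: "('v \<Rightarrow>\<^sub>0 nat) \<Rightarrow>\<^sub>0 'k"
  assume "f \<in> {f. keys f \<subseteq> A}" "g \<in> {f. keys f \<subseteq> A}"
  then show "f + g \<in> {f. keys f \<subseteq> A}"
    using keys_add[of f g] by auto
next
  fix f g :: "('v \<Rightarrow>\<^sub>0 nat) \<Rightarrow>\<^sub>0 'k"
  assume "f \<in> {f. keys f \<subseteq> A}"
  then show "g * f \<in> {f. keys f \<subseteq> A}"
    using assms keys_mult[of g f] by (force simp: up_closed_def add.commute)
qed auto

lemma is_ideal_var_pow: "is_ideal (var_pow C k)"
  unfolding var_pow_def by (rule is_ideal_mon_ideal) (auto simp: up_closed_def)

lemma monom_in_mon_ideal [simp]: "(monom a :: ('v \<Rightarrow>\<^sub>0 nat) \<Rightarrow>\<^sub>0 'k::field) \<in> mon_ideal A \<longleftrightarrow> a \<in> A"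
  by (simp add: mon_ideal_def monom_def)

lemma monom_mult: "monom a * monom b = (monom (a + b) :: ('v \<Rightarrow>\<^sub>0 nat) \<Rightarrow>\<^sub>0 'k::field)"
  by (simp add: monom_def mult_single)

text \<open>Every polynomial is the sum of its terms, and each term is a constant multiple of a
  monomial in \<open>K\<close>.\<close>

lemma mon_ideal_subset_ideal:
  fixes K :: "(('v \<Rightarrow>\<^sub>0 nat) \<Rightarrow>\<^sub>0 'k::field) set"
  assumes K: "is_ideal K" and A: "\<And>a. a \<in> A \<Longrightarrow> monom a \<in> K"
  shows "mon_ideal A \<subseteq> K"
proof
  fix f :: "('v \<Rightarrow>\<^sub>0 nat) \<Rightarrow>\<^sub>0 'k"
  assume "f \<in> mon_ideal A"
  then have "keys f \<subseteq> A" by (simp add: mon_ideal_def)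
  have *: "(\<Sum>a\<in>F. Poly_Mapping.single a (lookup f a)) \<in> K" if "finite F" "F \<subseteq> A" for F
    using that
  proof (induction F rule: finite_induct)
    case empty
    then show ?case using K by (simp add: is_ideal_def)
  next
    case (insert a F)
    have "Poly_Mapping.single a (lookup f a) = Poly_Mapping.single 0 (lookup f a) * monom a"
      by (simp add: monom_def mult_single)
    then show ?case
      using insert A K by (auto simp: is_ideal_def)
  qed
  have "f = (\<Sum>a\<in>keys f. Poly_Mapping.single a (lookup f a))"
    by (rule poly_mapping_eqI)
      (auto simp: lookup_sum lookup_single when_def in_keys_iff sum.delta')
  then show "f \<in> K"
    using *[of "keys f"] \<open>keys f \<subseteq> A\<close> by simp
qed

lemma mult_in_var_pow:
  "f \<in> var_pow C m \<Longrightarrow> g \<in> var_pow C n \<Longrightarrow> f * g \<in> var_pow C (m + n)"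
  using keys_mult[of f g] by (fastforce simp: var_pow_def mon_ideal_def)

lemma var_pow_antimono: "m \<le> n \<Longrightarrow> var_pow C n \<subseteq> var_pow C m"
  by (auto simp: var_pow_def mon_ideal_def)

lemma var_pow_0 [simp]: "var_pow C 0 = UNIV"
  by (auto simp: var_pow_def mon_ideal_def)

lemma one_in_var_pow [simp]: "(1 :: ('v \<Rightarrow>\<^sub>0 nat) \<Rightarrow>\<^sub>0 'k::field) \<in> var_pow C k \<longleftrightarrow> k = 0"
  by (auto simp: var_pow_def mon_ideal_def)

lemma power_in_var_pow: "f \<in> var_pow C m \<Longrightarrow> f ^ n \<in> var_pow C (m * n)"
proof (induction n)
  case (Suc n)
  then show ?case using mult_in_var_pow[of f C m "f ^ n" "m * n"] by simp
qed simp

text \<open>Together with \<open>mult_in_var_pow\<close> this makes the order along \<open>C\<close>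
  a valuation: orders at most \<open>m\<close> and \<open>n\<close> give a product of order at most
  \<open>m + n\<close>. Two exponents of least degree with a unique sum contribute a term that
  survives in the product.\<close>

lemma mult_notin_var_pow:
  fixes f g :: "('v::finite \<Rightarrow>\<^sub>0 nat) \<Rightarrow>\<^sub>0 'k::field"
  assumes f: "f \<notin> var_pow C (Suc m)" and g: "g \<notin> var_pow C (Suc n)"
  shows "f * g \<notin> var_pow C (Suc (m + n))"
proof -
  \<comment> \<open>This is the support of the initial form of \<open>p\<close> for the degree along
    \<open>C\<close>.\<close>
  define lowest where "lowest p = {a\<in>keys p. \<forall>c\<in>keys p. deg_on C a \<le> deg_on C c}"
    for p :: "('v \<Rightarrow>\<^sub>0 nat) \<Rightarrow>\<^sub>0 'k"
  have lowest: "lowest p \<noteq> {} \<and> (\<forall>a\<in>lowest p. deg_on C a \<le> k)"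
    if p: "p \<notin> var_pow C (Suc k)" for p k
  proof -
    have "\<exists>c\<in>keys p. \<not> Suc k \<le> deg_on C c"
      using p unfolding var_pow_def mon_ideal_def by blast
    then obtain c where c: "c \<in> keys p" "deg_on C c \<le> k"
      unfolding not_less_eq_eq by blast
    obtain a where "a \<in> keys p" "\<And>c. c \<in> keys p \<Longrightarrow> deg_on C a \<le> deg_on C c"
      using ex_has_least_nat[of "\<lambda>a. a \<in> keys p" c "deg_on C"] c(1) by blast
    then have "a \<in> lowest p" by (simp add: lowest_def)
    moreover have "deg_on C b \<le> k" if "b \<in> lowest p" for b
      using that c le_trans[of "deg_on C b" "deg_on C c" k] by (simp add: lowest_def)
    ultimately show ?thesis by blast
  qed
  have fin: "finite (lowest f)" "finite (lowest g)"
    by (simp_all add: lowest_def)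
  have ne: "lowest f \<noteq> {}" "lowest g \<noteq> {}"
    using lowest f g by auto
  obtain a b where ab: "a \<in> lowest f" "b \<in> lowest g" and
    uniq: "\<And>a' b'. a' \<in> lowest f \<Longrightarrow> b' \<in> lowest g \<Longrightarrow> a' + b' = a + b \<Longrightarrow> a' = a \<and> b' = b"
    by (rule unique_sum[OF fin ne]) (rule that)
  have "lookup (f * g) (a + b) = lookup f a * lookup g b"
  proof (rule lookup_mult_unique)
    fix a' b' assume *: "a' \<in> keys f" "b' \<in> keys g" "a' + b' = a + b"
    then have "deg_on C a' + deg_on C b' = deg_on C a + deg_on C b"
      by (metis deg_on_add)
    moreover have "deg_on C a \<le> deg_on C a'" "deg_on C b \<le> deg_on C b'"
      using ab * by (auto simp: lowest_def)
    ultimately have "deg_on C a' = deg_on C a" "deg_on C b' = deg_on C b"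
      by auto
    then have "a' \<in> lowest f" "b' \<in> lowest g"
      using ab * by (auto simp: lowest_def)
    then show "a' = a \<and> b' = b"
      using uniq *(3) by blast
  qed
  then have "a + b \<in> keys (f * g)"
    using ab by (auto simp: in_keys_iff lowest_def)
  moreover have "deg_on C (a + b) \<le> m + n"
    using ab lowest[OF f] lowest[OF g] by (auto intro: add_mono)
  ultimately show ?thesis
    by (force simp: var_pow_def mon_ideal_def)
qed

text \<open>If \<open>g\<close> has order 0, then \<open>f * g\<close> has the same order as
  \<open>f\<close>, hence order below \<open>k\<close>. The case \<open>k = 1\<close> is primality;
  for larger \<open>k\<close> this is primariness with the radical made explicit.\<close>

lemma var_pow_primary:
  fixes f g :: "('v::finite \<Rightarrow>\<^sub>0 nat) \<Rightarrow>\<^sub>0 'k::field"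
  assumes "f * g \<in> var_pow C k" "f \<notin> var_pow C k"
  shows "g \<in> var_pow C 1"
proof -
  obtain m where "k = Suc m" using assms by (cases k) auto
  then show ?thesis using mult_notin_var_pow[of f C m g 0] assms by auto
qed

lemma power_notin_var_pow:
  fixes f :: "('v::finite \<Rightarrow>\<^sub>0 nat) \<Rightarrow>\<^sub>0 'k::field"
  assumes "f \<notin> var_pow C (Suc d)"
  shows "f ^ n \<notin> var_pow C (Suc (n * d))"
proof (induction n)
  case (Suc n)
  then show ?case using mult_notin_var_pow[OF assms Suc] by simp
qed simp

lemma prime_ideal_var_pow:
  "prime_ideal (var_pow C 1 :: (('v::finite \<Rightarrow>\<^sub>0 nat) \<Rightarrow>\<^sub>0 'k::field) set)"
proof -
  have "var_pow C 1 \<noteq> (UNIV :: (('v \<Rightarrow>\<^sub>0 nat) \<Rightarrow>\<^sub>0 'k) set)"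
    using one_in_var_pow[of C 1] by (metis UNIV_I one_neq_zero)
  then show ?thesis
    using is_ideal_var_pow[of C 1] var_pow_primary[of _ _ C 1]
    by (auto simp: prime_ideal_def)
qed

lemma primary_ideal_var_pow:
  assumes "k \<ge> 1"
  shows "primary_ideal (var_pow C k :: (('v::finite \<Rightarrow>\<^sub>0 nat) \<Rightarrow>\<^sub>0 'k::field) set)"
proof -
  have "\<exists>m. g ^ m \<in> var_pow C k" if "f * g \<in> var_pow C k" "f \<notin> var_pow C k"
    for f g :: "('v \<Rightarrow>\<^sub>0 nat) \<Rightarrow>\<^sub>0 'k"
    using power_in_var_pow[OF var_pow_primary[OF that], of k] by auto
  then show ?thesis
    using is_ideal_var_pow[of C k] one_in_var_pow[of C k] assms
    unfolding primary_ideal_def by fastforce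
qed

lemma keys_mult_monom:
  fixes f :: "('v::finite \<Rightarrow>\<^sub>0 nat) \<Rightarrow>\<^sub>0 'k::field"
  shows "keys (f * monom b) = (\<lambda>a. a + b) ` keys f"
proof
  show "keys (f * monom b) \<subseteq> (\<lambda>a. a + b) ` keys f"
    using keys_mult[of f "monom b :: ('v \<Rightarrow>\<^sub>0 nat) \<Rightarrow>\<^sub>0 'k"] by (auto simp: monom_def)
  have "lookup (f * monom b) (a + b) = lookup f a" for a
    using lookup_mult_unique[of f "monom b" a b] by (simp add: monom_def)
  then show "(\<lambda>a. a + b) ` keys f \<subseteq> keys (f * monom b)"
    by (auto simp: in_keys_iff)
qed

section \<open>Edge ideals and vertex covers\<close>

lemma is_ideal_ideal_gen: "is_ideal (ideal_gen S)"
  by (auto simp: is_ideal_def ideal_gen_def)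

lemma ideal_gen_superset: "S \<subseteq> ideal_gen S"
  by (auto simp: ideal_gen_def)

lemma ideal_gen_least: "is_ideal I \<Longrightarrow> S \<subseteq> I \<Longrightarrow> ideal_gen S \<subseteq> I"
  by (auto simp: ideal_gen_def)

section \<open>Powers of monomial ideals in terms of exponents\<close>

fun exps_pow :: "('v \<Rightarrow>\<^sub>0 nat) set \<Rightarrow> nat \<Rightarrow> ('v \<Rightarrow>\<^sub>0 nat) set" where
  "exps_pow A 0 = UNIV"
| "exps_pow A (Suc k) = {a + b | a b. a \<in> exps_pow A k \<and> b \<in> A}"

lemma up_closed_plus: "up_closed B \<Longrightarrow> up_closed {a + b | a b. a \<in> A \<and> b \<in> B}"
  unfolding up_closed_def by (auto simp: add.assoc) blast

lemma up_closed_exps_pow: "up_closed A \<Longrightarrow> up_closed (exps_pow A k)"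
proof (cases k)
  case (Suc m)
  then show "up_closed A \<Longrightarrow> up_closed (exps_pow A k)"
    using up_closed_plus[of A "exps_pow A m"] by simp
qed (simp add: up_closed_def)

lemma exps_pow_mono: "A \<subseteq> B \<Longrightarrow> exps_pow A k \<subseteq> exps_pow B k"
  by (induction k) auto

lemma ideal_prod_mon_ideal:
  fixes A B :: "('v \<Rightarrow>\<^sub>0 nat) set"
  assumes "up_closed B"
  shows "ideal_prod (mon_ideal A) (mon_ideal B) =
    (mon_ideal {a + b | a b. a \<in> A \<and> b \<in> B} :: (('v \<Rightarrow>\<^sub>0 nat) \<Rightarrow>\<^sub>0 'k::field) set)"
proof
  show "ideal_prod (mon_ideal A) (mon_ideal B) \<subseteq>
    (mon_ideal {a + b | a b. a \<in> A \<and> b \<in> B} :: (('v \<Rightarrow>\<^sub>0 nat) \<Rightarrow>\<^sub>0 'k) set)"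
    unfolding ideal_prod_def
  proof (rule ideal_gen_least[OF is_ideal_mon_ideal[OF up_closed_plus[OF assms]]], safe)
    fix f g :: "('v \<Rightarrow>\<^sub>0 nat) \<Rightarrow>\<^sub>0 'k"
    assume "f \<in> mon_ideal A" "g \<in> mon_ideal B"
    then show "f * g \<in> mon_ideal {a + b | a b. a \<in> A \<and> b \<in> B}"
      using keys_mult[of f g] unfolding mon_ideal_def by blast
  qed
  show "(mon_ideal {a + b | a b. a \<in> A \<and> b \<in> B} :: (('v \<Rightarrow>\<^sub>0 nat) \<Rightarrow>\<^sub>0 'k) set) \<subseteq>
    ideal_prod (mon_ideal A) (mon_ideal B)"
  proof (rule mon_ideal_subset_ideal)
    fix c assume "c \<in> {a + b | a b. a \<in> A \<and> b \<in> B}"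
    then obtain a b where "c = a + b" "a \<in> A" "b \<in> B" by blast
    then show "(monom c :: ('v \<Rightarrow>\<^sub>0 nat) \<Rightarrow>\<^sub>0 'k) \<in> ideal_prod (mon_ideal A) (mon_ideal B)"
      unfolding ideal_prod_def
      by (intro subsetD[OF ideal_gen_superset])
        (use monom_in_mon_ideal in \<open>fastforce simp: monom_mult[symmetric]\<close>)
  qed (simp add: ideal_prod_def is_ideal_ideal_gen)
qed

lemma ideal_pow_mon_ideal:
  assumes "up_closed A"
  shows "ideal_pow (mon_ideal A) k =
    (mon_ideal (exps_pow A k) :: (('v \<Rightarrow>\<^sub>0 nat) \<Rightarrow>\<^sub>0 'k::field) set)"
proof (induction k)
  case 0
  then show ?case by (auto simp: mon_ideal_def)
next
  case (Suc k)
  then show ?case by (simp add: ideal_prod_mon_ideal[OF assms])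
qed

section \<open>Hypergraphs, minimal covers and packing\<close>

definition edge_exps :: "'v set set \<Rightarrow> ('v \<Rightarrow>\<^sub>0 nat) set" where
  "edge_exps H = {a. \<exists>e\<in>H. e \<subseteq> keys a}"

definition cover :: "'v set set \<Rightarrow> 'v set \<Rightarrow> bool" where
  "cover H C \<longleftrightarrow> (\<forall>e\<in>H. e \<inter> C \<noteq> {})"

text \<open>Minimality is encoded by a private edge for every vertex, the form in which it is used.
  \<open>ex_mincover\<close> and \<open>mincover_unique\<close> relate it to minimality under
  inclusion.\<close>

definition mincover :: "'v set set \<Rightarrow> 'v set \<Rightarrow> bool" where
  "mincover H C \<longleftrightarrow> cover H C \<and> (\<forall>i\<in>C. \<exists>e\<in>H. e \<inter> C = {i})"

text \<open>These are the exponents of the monomials in the \<open>k\<close>-th symbolic power, that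
  is, in the intersection of the ideals \<open>var_pow C k\<close>.\<close>

definition symb_exps :: "'v set set \<Rightarrow> nat \<Rightarrow> ('v \<Rightarrow>\<^sub>0 nat) set" where
  "symb_exps H k = {a. \<forall>C. mincover H C \<longrightarrow> k \<le> deg_on C a}"

text \<open>Ordinary and symbolic powers of the edge ideal agree; equivalently, the hypergraph has the
  max-flow min-cut property.\<close>
definition mengerian :: "'v set set \<Rightarrow> bool" where
  "mengerian H \<longleftrightarrow> (\<forall>k. symb_exps H k \<subseteq> exps_pow (edge_exps H) k)"

lemma keys_plus_nat: "keys (a + b) = keys a \<union> keys (b :: 'v \<Rightarrow>\<^sub>0 nat)"
  by (auto simp: in_keys_iff lookup_add)

lemma up_closed_edge_exps: "up_closed (edge_exps H)"
  by (auto simp: up_closed_def edge_exps_def keys_plus_nat)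

lemma deg_on_mono: "finite D \<Longrightarrow> C \<subseteq> D \<Longrightarrow> deg_on C a \<le> deg_on D a"
  by (simp add: deg_on_def sum_mono2)

lemma deg_on_ge_1: "finite C \<Longrightarrow> 1 \<le> deg_on C a \<longleftrightarrow> keys a \<inter> C \<noteq> {}"
  by (auto simp: deg_on_def in_keys_iff Suc_le_eq sum_eq_0_iff simp flip: neq0_conv)

text \<open>A cover of least cardinality inside \<open>C\<close> works: an edge that is no longer
  met after deleting \<open>i\<close> is a private edge of \<open>i\<close>.\<close>

lemma ex_mincover:
  fixes C :: "'v::finite set"
  assumes "cover H C"
  obtains D where "mincover H D" "D \<subseteq> C"
proof -
  obtain D where D: "cover H D \<and> D \<subseteq> C"
    and least: "\<And>D'. cover H D' \<and> D' \<subseteq> C \<Longrightarrow> card D \<le> card D'"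
    using assms ex_has_least_nat[of "\<lambda>D. cover H D \<and> D \<subseteq> C" C card] by auto
  have "\<exists>e\<in>H. e \<inter> D = {i}" if "i \<in> D" for i
  proof -
    have "card (D - {i}) < card D"
      using that by (meson card_Diff1_less finite)
    then have "\<not> cover H (D - {i})"
      using least[of "D - {i}"] D by force
    then show ?thesis
      using D that by (fastforce simp: cover_def)
  qed
  then show thesis
    using that[of D] D by (simp add: mincover_def)
qed

text \<open>Every edge meets every cover, so each of the \<open>k\<close> summands adds at least one
  to the degree along \<open>C\<close>. This is the inclusion that holds for all
  hypergraphs.\<close>

lemma exps_pow_subset_symb_exps:
  fixes H :: "'v::finite set set"
  shows "exps_pow (edge_exps H) k \<subseteq> symb_exps H k"
proof (induction k)
  case (Suc k)
  have "1 \<le> deg_on C b" if "b \<in> edge_exps H" "mincover H C" for b C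
    using that by (auto simp: edge_exps_def mincover_def cover_def deg_on_ge_1[simplified])
      (metis disjoint_iff in_mono)
  then show ?case
    using Suc by (fastforce simp: symb_exps_def)
qed (auto simp: symb_exps_def)

lemma symb_exps_cover:
  fixes H :: "'v::finite set set"
  assumes "w \<in> symb_exps H k" "cover H C"
  shows "k \<le> deg_on C w"
proof -
  obtain D where "mincover H D" "D \<subseteq> C" using ex_mincover assms by blast
  then show ?thesis
    using assms(1) deg_on_mono[of C D w] by (fastforce simp: symb_exps_def)
qed

definition indicator_exp :: "'v::finite set \<Rightarrow> ('v \<Rightarrow>\<^sub>0 nat)" where
  "indicator_exp e = Abs_poly_mapping (\<lambda>i. if i \<in> e then 1 else 0)"

lemma lookup_indicator_exp [simp]: "lookup (indicator_exp e) i = (if i \<in> e then 1 else 0)"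
  by (simp add: indicator_exp_def lookup_Abs_poly_mapping)

lemma keys_indicator_exp [simp]: "keys (indicator_exp e) = e"
  by (auto simp: in_keys_iff split: if_splits)

lemma deg_on_indicator_exp [simp]: "deg_on C (indicator_exp e) = card (e \<inter> C)"
  by (simp add: deg_on_def sum.If_cases Int_commute)

lemma minus_indicator_exp: "e \<subseteq> keys w \<Longrightarrow> w = (w - indicator_exp e) + indicator_exp e"
  by (rule poly_mapping_eqI) (auto simp: lookup_add lookup_minus in_keys_iff subset_iff)

text \<open>Pack copies of the new edge greedily: as long as its vertices all have positive weight,
  removing one copy decreases the weight of every minimal cover by at most one; once a vertex \<open>t\<close> of
  weight zero appears, any cover of \<open>H\<close> extends by \<open>t\<close> at no cost to a cover of \<open>insert h H\<close>.\<close>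
lemma mengerian_insert:
  fixes H :: "'v::finite set set"
  assumes H: "mengerian H"
    and h: "\<And>C i j. mincover (insert h H) C \<Longrightarrow> i \<in> C \<inter> h \<Longrightarrow> j \<in> C \<inter> h \<Longrightarrow> i = j"
  shows "mengerian (insert h H)"
  unfolding mengerian_def
proof
  fix k
  show "symb_exps (insert h H) k \<subseteq> exps_pow (edge_exps (insert h H)) k"
  proof (induction k)
    case 0
    then show ?case by simp
  next
    case (Suc k)
    show ?case
    proof
      fix w assume w: "w \<in> symb_exps (insert h H) (Suc k)"
      show "w \<in> exps_pow (edge_exps (insert h H)) (Suc k)"
      proof (cases "h \<subseteq> keys w")
        case True
        note eq = minus_indicator_exp[OF True]
        have "k \<le> deg_on C (w - indicator_exp h)" if C: "mincover (insert h H) C" for C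
        proof -
          have "card (h \<inter> C) \<le> Suc 0"
            using h[OF C] by (subst card_le_Suc0_iff_eq) auto
          moreover have "Suc k \<le> deg_on C (w - indicator_exp h) + card (h \<inter> C)"
            using w C eq deg_on_add[of C "w - indicator_exp h" "indicator_exp h"]
            by (auto simp: symb_exps_def)
          ultimately show ?thesis by simp
        qed
        then have "w - indicator_exp h \<in> exps_pow (edge_exps (insert h H)) k"
          using Suc by (auto simp: symb_exps_def)
        moreover have "indicator_exp h \<in> edge_exps (insert h H)"
          by (auto simp: edge_exps_def)
        ultimately show ?thesis
          using eq by auto
      next
        case False
        then obtain t where t: "t \<in> h" "lookup w t = 0"
          unfolding subset_iff in_keys_iff by blast
        have "Suc k \<le> deg_on C w" if "mincover H C" for C
        proof -
          have "cover (insert h H) (insert t C)"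
            using that t by (auto simp: mincover_def cover_def)
          then have "Suc k \<le> deg_on (insert t C) w"
            by (rule symb_exps_cover[OF w])
          also have "deg_on (insert t C) w = deg_on C w"
            using t by (cases "t \<in> C") (auto simp: deg_on_def insert_absorb)
          finally show ?thesis .
        qed
        then have "w \<in> exps_pow (edge_exps H) (Suc k)"
          using H unfolding mengerian_def symb_exps_def by blast
        moreover have "edge_exps H \<subseteq> edge_exps (insert h H)"
          by (auto simp: edge_exps_def)
        ultimately show ?thesis
          using exps_pow_mono by blast
      qed
    qed
  qed
qed

lemma mengerian_ideal_pow:
  fixes H :: "'v::finite set set"
  assumes "mengerian H"
  shows "ideal_pow (mon_ideal (edge_exps H)) k =
    (\<Inter>C\<in>Collect (mincover H). var_pow C k :: (('v \<Rightarrow>\<^sub>0 nat) \<Rightarrow>\<^sub>0 'k::field) set)"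
proof -
  have "exps_pow (edge_exps H) k = symb_exps H k"
    using assms exps_pow_subset_symb_exps[of H k] unfolding mengerian_def by blast
  then show ?thesis
    unfolding ideal_pow_mon_ideal[OF up_closed_edge_exps]
    by (auto simp: var_pow_def mon_ideal_def symb_exps_def)
qed

section \<open>Prime ideals, radicals and the variables they contain\<close>

lemma prime_ideal_prod:
  assumes P: "prime_ideal P" and "finite X" "(\<Prod>x\<in>X. f x) \<in> P"
  shows "\<exists>x\<in>X. f x \<in> P"
  using assms(2,3)
proof (induction X rule: finite_induct)
  case empty
  have "r \<in> P" for r
    using empty P by (metis is_ideal_def mult.right_neutral prime_ideal_def prod.empty)
  then show ?case using P by (auto simp: prime_ideal_def)
next
  case (insert x X)
  then show ?case using P by (auto simp: prime_ideal_def)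
qed

lemma prime_ideal_power: "prime_ideal P \<Longrightarrow> f ^ n \<in> P \<Longrightarrow> f \<in> P"
  using prime_ideal_prod[of P "{..<n}" "\<lambda>_. f"] by simp

lemma is_ideal_mult_left: "is_ideal I \<Longrightarrow> a \<in> I \<Longrightarrow> r * a \<in> I"
  by (simp add: is_ideal_def)

lemma is_ideal_mult_right: "is_ideal I \<Longrightarrow> a \<in> I \<Longrightarrow> a * r \<in> I"
  by (metis is_ideal_def mult.commute)

lemma is_ideal_sum: "is_ideal I \<Longrightarrow> (\<And>x. x \<in> X \<Longrightarrow> f x \<in> I) \<Longrightarrow> sum f X \<in> I"
  by (induction X rule: infinite_finite_induct) (auto simp: is_ideal_def)

lemma is_ideal_uminus:
  assumes "is_ideal I" "a \<in> I"
  shows "- a \<in> I"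
  using is_ideal_mult_left[OF assms, of "- 1"] by simp

lemma var_in_var_pow [simp]:
  "(var i :: ('v::finite \<Rightarrow>\<^sub>0 nat) \<Rightarrow>\<^sub>0 'k::field) \<in> var_pow C (Suc 0) \<longleftrightarrow> i \<in> C"
  by (simp add: var_def var_pow_def deg_on_ge_1[simplified])

lemma monom_in_var_pow [simp]:
  "(monom a :: ('v \<Rightarrow>\<^sub>0 nat) \<Rightarrow>\<^sub>0 'k::field) \<in> var_pow C k \<longleftrightarrow> k \<le> deg_on C a"
  by (simp add: var_pow_def)

lemma monom_indicator_exp:
  "(monom (indicator_exp e) :: ('v::finite \<Rightarrow>\<^sub>0 nat) \<Rightarrow>\<^sub>0 'k::field) = (\<Prod>i\<in>e. var i)"
proof -
  have "finite e" by simp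
  then show ?thesis
  proof (induction e rule: finite_induct)
    case empty
    have "indicator_exp ({} :: 'v set) = 0" by (rule poly_mapping_eqI) simp
    then show ?case by (simp add: monom_def)
  next
    case (insert i e)
    have "indicator_exp (insert i e) = Poly_Mapping.single i 1 + indicator_exp e"
      using insert.hyps by (intro poly_mapping_eqI) (auto simp: lookup_add lookup_single when_def)
    then show ?case using insert by (simp add: monom_mult[symmetric] var_def)
  qed
qed

lemma monom_in_ideal:
  assumes I: "is_ideal I" and e: "monom (indicator_exp e) \<in> I" "e \<subseteq> keys a"
  shows "(monom a :: ('v::finite \<Rightarrow>\<^sub>0 nat) \<Rightarrow>\<^sub>0 'k::field) \<in> I"
  using minus_indicator_exp[OF e(2)] is_ideal_mult_left[OF I e(1)] by (metis monom_mult)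

lemma var_pow_1_subset_ideal:
  fixes P :: "(('v::finite \<Rightarrow>\<^sub>0 nat) \<Rightarrow>\<^sub>0 'k::field) set"
  assumes P: "is_ideal P" "\<And>i. i \<in> C \<Longrightarrow> var i \<in> P"
  shows "var_pow C 1 \<subseteq> P"
  unfolding var_pow_def
proof (rule mon_ideal_subset_ideal[OF P(1)])
  fix a :: "'v \<Rightarrow>\<^sub>0 nat" assume "a \<in> {a. 1 \<le> deg_on C a}"
  then obtain i where i: "i \<in> keys a" "i \<in> C"
    using deg_on_ge_1[of C a] by auto
  have "indicator_exp {i} = Poly_Mapping.single i 1"
    by (rule poly_mapping_eqI) (auto simp: lookup_single when_def)
  then show "monom a \<in> P"
    using monom_in_ideal[OF P(1), of "{i}" a] P(2)[OF i(2)] i(1) by (simp add: var_def)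
qed

lemma ideal_radical_superset: "Q \<subseteq> ideal_radical Q"
  unfolding ideal_radical_def by (metis (mono_tags, lifting) mem_Collect_eq power_one_right subsetI)

lemma is_ideal_radical:
  assumes Q: "is_ideal Q"
  shows "is_ideal (ideal_radical Q)"
proof -
  have "a + b \<in> ideal_radical Q" if ab: "a \<in> ideal_radical Q" "b \<in> ideal_radical Q" for a b
  proof -
    obtain m n where mn: "a ^ m \<in> Q" "b ^ n \<in> Q"
      using ab unfolding ideal_radical_def by blast
    have "of_nat (m + n choose i) * a ^ i * b ^ (m + n - i) \<in> Q" for i
    proof (cases "m \<le> i")
      case True
      then have "a ^ i = a ^ (i - m) * a ^ m" by (simp flip: power_add)
      then show ?thesis using mn(1) Q is_ideal_mult_left is_ideal_mult_right by metis
    next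
      case False
      then have "b ^ (m + n - i) = b ^ (m - i) * b ^ n" by (simp flip: power_add)
      then show ?thesis using mn(2) Q is_ideal_mult_left by metis
    qed
    then have "(a + b) ^ (m + n) \<in> Q"
      unfolding binomial_ring by (intro is_ideal_sum Q)
    then show ?thesis by (auto simp: ideal_radical_def)
  qed
  moreover have "r * a \<in> ideal_radical Q" if "a \<in> ideal_radical Q" for a r
    using that is_ideal_mult_left[OF Q] by (auto simp: ideal_radical_def power_mult_distrib)
  moreover have "0 \<in> ideal_radical Q"
    using Q ideal_radical_superset by (auto simp: is_ideal_def)
  ultimately show ?thesis by (auto simp: is_ideal_def)
qed

text \<open>Needed because \<open>symbolic_power\<close> refers to arbitrary primary decompositions,
  whose components need not be monomial ideals.\<close>

lemma prime_ideal_radical: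
  assumes "primary_ideal Q"
  shows "prime_ideal (ideal_radical Q)"
proof -
  have Q: "is_ideal Q" "Q \<noteq> UNIV" and prim: "\<And>a b. a * b \<in> Q \<Longrightarrow> a \<in> Q \<or> (\<exists>m. b ^ m \<in> Q)"
    using assms by (auto simp: primary_ideal_def)
  have "1 \<notin> Q"
    using Q is_ideal_mult_left[OF Q(1), of 1] by auto
  then have "1 \<notin> ideal_radical Q"
    by (simp add: ideal_radical_def)
  moreover have "a \<in> ideal_radical Q \<or> b \<in> ideal_radical Q" if ab: "a * b \<in> ideal_radical Q" for a b
  proof -
    obtain m where "a ^ m * b ^ m \<in> Q"
      using ab by (auto simp: ideal_radical_def power_mult_distrib)
    then have "a ^ m \<in> Q \<or> (\<exists>n. b ^ (m * n) \<in> Q)"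
      using prim by (auto simp: power_mult)
    then show ?thesis by (auto simp: ideal_radical_def)
  qed
  ultimately show ?thesis
    using is_ideal_radical[OF Q(1)] unfolding prime_ideal_def by blast
qed

section \<open>Consequences of the primary decomposition of all powers\<close>

locale mengerian_ideal =
  fixes H :: "'v::finite set set" and J :: "(('v \<Rightarrow>\<^sub>0 nat) \<Rightarrow>\<^sub>0 'k::field) set"
  assumes mengerian: "mengerian H" and J: "J = mon_ideal (edge_exps H)" and H_ne: "H \<noteq> {}"
begin

lemma pow_eq: "ideal_pow J k = (\<Inter>C\<in>Collect (mincover H). var_pow C k)"
  unfolding J by (rule mengerian_ideal_pow[OF mengerian])

lemma J_eq: "J = (\<Inter>C\<in>Collect (mincover H). var_pow C 1)"
proof -
  \<comment> \<open>The first power is by definition the product of the whole ring with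
    \<open>J\<close>; on exponents this is the sum of \<open>UNIV\<close> and an upward closed
    set.\<close>
  have "exps_pow (edge_exps H) (Suc 0) = edge_exps H"
  proof
    show "exps_pow (edge_exps H) (Suc 0) \<subseteq> edge_exps H"
      using up_closed_edge_exps[of H] by (auto simp: up_closed_def) (metis add.commute)
    show "edge_exps H \<subseteq> exps_pow (edge_exps H) (Suc 0)"
      by (auto intro: exI[of _ 0])
  qed
  then have "ideal_pow J 1 = J"
    unfolding J ideal_pow_mon_ideal[OF up_closed_edge_exps] by simp
  then show ?thesis using pow_eq[of 1] by simp
qed

lemma edge_in_J: "e \<in> H \<Longrightarrow> monom (indicator_exp e) \<in> J"
  by (auto simp: J edge_exps_def)

text \<open>As \<open>H\<close> has an edge, the empty set is no cover. Every minimal cover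
  therefore offers a vertex with a private edge. If \<open>H\<close> contains the empty edge there
  is no cover at all, and the intersections are the whole ring.\<close>

lemma mincover_ne: "mincover H C \<Longrightarrow> C \<noteq> {}"
  using H_ne by (auto simp: mincover_def cover_def)

text \<open>A private edge of \<open>i\<close> in \<open>C\<close> can meet a subset of
  \<open>C\<close> only in \<open>i\<close>, so every cover inside \<open>C\<close> contains
  \<open>i\<close>.\<close>

lemma mincover_unique:
  assumes "mincover H C" "cover H D" "D \<subseteq> C"
  shows "D = C"
proof (intro subset_antisym assms(3) subsetI[of C D])
  fix i assume "i \<in> C"
  then obtain e where e: "e \<in> H" "e \<inter> C = {i}"
    using assms(1) unfolding mincover_def by blast
  then obtain j where "j \<in> e" "j \<in> D"
    using assms(2) unfolding cover_def by blast
  moreover from this have "j \<in> e \<inter> C" using assms(3) by blast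
  ultimately show "i \<in> D" using e(2) by simp
qed

text \<open>For each edge, \<open>P\<close> contains the product of its variables and hence one of
  them. So the variables in \<open>P\<close> form a cover.\<close>

lemma prime_contains_mincover:
  assumes P: "prime_ideal P" "J \<subseteq> P"
  obtains C where "mincover H C" "var_pow C 1 \<subseteq> P"
proof -
  have "cover H {i. var i \<in> P}"
    unfolding cover_def
  proof
    fix e assume "e \<in> H"
    then have "(\<Prod>i\<in>e. var i) \<in> P"
      using edge_in_J P(2) by (auto simp: monom_indicator_exp)
    then have "\<exists>i\<in>e. var i \<in> P"
      using prime_ideal_prod[OF P(1), of e var] by simp
    then show "e \<inter> {i. var i \<in> P} \<noteq> {}" by blast
  qed
  then obtain C where "mincover H C" "C \<subseteq> {i. var i \<in> P}"
    by (rule ex_mincover)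
  then show thesis
    using that var_pow_1_subset_ideal[of P C] P(1) by (auto simp: prime_ideal_def)
qed

lemma J_subset_var_pow: "mincover H C \<Longrightarrow> J \<subseteq> var_pow C 1"
  using J_eq by auto

lemma var_pow_1_subset_iff:
  "(var_pow C 1 :: (('v \<Rightarrow>\<^sub>0 nat) \<Rightarrow>\<^sub>0 'k) set) \<subseteq> var_pow D 1 \<longleftrightarrow> C \<subseteq> D"
proof
  assume "(var_pow C 1 :: (('v \<Rightarrow>\<^sub>0 nat) \<Rightarrow>\<^sub>0 'k) set) \<subseteq> var_pow D 1"
  then show "C \<subseteq> D" using var_in_var_pow[folded One_nat_def] by blast
next
  assume "C \<subseteq> D"
  then have "{a. 1 \<le> deg_on C a} \<subseteq> {a. 1 \<le> deg_on D a}"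
    by (simp only: deg_on_ge_1 finite) blast
  then show "(var_pow C 1 :: (('v \<Rightarrow>\<^sub>0 nat) \<Rightarrow>\<^sub>0 'k) set) \<subseteq> var_pow D 1"
    unfolding var_pow_def mon_ideal_def by blast
qed

lemma Min_primes_eq: "Min_primes J = (\<lambda>C. var_pow C 1) ` Collect (mincover H)"
proof (intro set_eqI iffI)
  fix P assume "P \<in> Min_primes J"
  then have P: "prime_ideal P" "J \<subseteq> P"
    and least: "\<And>Q. prime_ideal Q \<Longrightarrow> J \<subseteq> Q \<Longrightarrow> Q \<subseteq> P \<Longrightarrow> Q = P"
    by (auto simp: Min_primes_def)
  from P obtain C where C: "mincover H C" "var_pow C 1 \<subseteq> P"
    by (rule prime_contains_mincover)
  then have "var_pow C 1 = P"
    by (intro least prime_ideal_var_pow J_subset_var_pow)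
  then show "P \<in> (\<lambda>C. var_pow C 1) ` Collect (mincover H)" using C by blast
next
  fix P :: "(('v \<Rightarrow>\<^sub>0 nat) \<Rightarrow>\<^sub>0 'k) set"
  assume "P \<in> (\<lambda>C. var_pow C 1) ` Collect (mincover H)"
  then obtain C where P: "P = var_pow C 1" and C: "mincover H C" by blast
  have "Q = P" if Q: "prime_ideal Q" "J \<subseteq> Q" "Q \<subseteq> P" for Q
  proof -
    obtain D where D: "mincover H D" "var_pow D 1 \<subseteq> Q"
      using Q(1,2) by (rule prime_contains_mincover)
    then have "D \<subseteq> C"
      using Q(3) var_pow_1_subset_iff[of D C] by (auto simp: P)
    then have "D = C"
      using mincover_unique[OF C] D by (auto simp: mincover_def)
    then show ?thesis using D Q(3) by (auto simp: P)
  qed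
  then show "P \<in> Min_primes J"
    using prime_ideal_var_pow[of C] J_subset_var_pow[OF C] by (auto simp: Min_primes_def P)
qed

lemma var_pow_in_Ass:
  assumes C: "mincover H C" and k: "k \<ge> 1"
  shows "var_pow C 1 \<in> Ass (ideal_pow J k)"
proof -
  obtain i where i: "i \<in> C" using mincover_ne[OF C] by blast
  \<comment> \<open>The degree along \<open>C\<close> is exactly \<open>k - 1\<close>, one short of
    membership. A different minimal cover is not contained in \<open>C\<close>, so the
    \<open>k\<close> copies of the complement already give it degree at least \<open>k\<close>. Only
    the component of \<open>C\<close> is left in the colon ideal.\<close>
  define b where "b = (\<Sum>j<k. indicator_exp (- C)) + (\<Sum>j<k-1. indicator_exp {i})"
  have sum: "deg_on D (\<Sum>j<n. indicator_exp e) = n * card (e \<inter> D)" for D :: "'v set" and e n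
    by (induction n) auto
  have bC: "deg_on C b = k - 1"
    using i by (simp add: b_def sum)
  have bD: "k \<le> deg_on D b" if "mincover H D" "D \<noteq> C" for D
  proof -
    have "\<not> D \<subseteq> C" using mincover_unique[OF C, of D] that by (auto simp: mincover_def)
    then have "1 \<le> card (- C \<inter> D)" by (auto simp: Suc_le_eq card_gt_0_iff)
    then have "k \<le> k * card (- C \<inter> D)" by simp
    then show ?thesis unfolding b_def deg_on_add sum by (rule trans_le_add1)
  qed
  have "ideal_colon (ideal_pow J k) {monom b} = var_pow C 1"
  proof (intro set_eqI)
    fix f :: "('v \<Rightarrow>\<^sub>0 nat) \<Rightarrow>\<^sub>0 'k"
    have "f \<in> ideal_colon (ideal_pow J k) {monom b} \<longleftrightarrow>
      (\<forall>D. mincover H D \<longrightarrow> f * monom b \<in> var_pow D k)"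
      by (simp add: ideal_colon_def pow_eq)
    also have "\<dots> \<longleftrightarrow> f * monom b \<in> var_pow C k"
      using bD C is_ideal_mult_left[OF is_ideal_var_pow] monom_in_var_pow by metis
    also have "\<dots> \<longleftrightarrow> f \<in> var_pow C 1"
      using k bC by (auto simp: var_pow_def mon_ideal_def keys_mult_monom)
    finally show "f \<in> ideal_colon (ideal_pow J k) {monom b} \<longleftrightarrow> f \<in> var_pow C 1" .
  qed
  then show ?thesis
    using prime_ideal_var_pow[of C] unfolding Ass_def by blast
qed

text \<open>The prime \<open>P\<close> is a finite intersection of the ideals
  \<open>var_pow C k\<close> : \<open>f\<close>, so it contains one of them, and that one can be
  taken with \<open>f\<close> outside \<open>var_pow C k\<close>. Its radical is
  \<open>var_pow C 1\<close>, which forces equality.\<close>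

lemma Ass_subset:
  assumes "P \<in> Ass (ideal_pow J k)"
  shows "P \<in> (\<lambda>C. var_pow C 1) ` Collect (mincover H)"
proof -
  obtain f where P: "prime_ideal P" and f: "P = ideal_colon (ideal_pow J k) {f}"
    using assms by (auto simp: Ass_def)
  have P_iff: "g \<in> P \<longleftrightarrow> (\<forall>C. mincover H C \<longrightarrow> g * f \<in> var_pow C k)" for g
    by (simp add: f ideal_colon_def pow_eq)
  have "\<exists>C. mincover H C \<and> f \<notin> var_pow C k \<and> (\<forall>g. g * f \<in> var_pow C k \<longrightarrow> g \<in> P)"
  proof (rule ccontr)
    assume contra: "\<not> ?thesis"
    define X where "X = {C. mincover H C \<and> f \<notin> var_pow C k}"
    have "\<forall>C\<in>X. \<exists>g. g * f \<in> var_pow C k \<and> g \<notin> P"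
      using contra unfolding X_def by blast
    \<comment> \<open>The product of these witnesses carries \<open>f\<close> into every component,
      so it lies in \<open>P\<close> although none of its factors does.\<close>
    then obtain g where g: "\<And>C. C \<in> X \<Longrightarrow> g C * f \<in> var_pow C k \<and> g C \<notin> P"
      by metis
    have "(\<Prod>C\<in>X. g C) * f \<in> var_pow C k" if "mincover H C" for C
    proof (cases "C \<in> X")
      case True
      then have "(\<Prod>C\<in>X. g C) * f = (\<Prod>C\<in>X-{C}. g C) * (g C * f)"
        by (simp add: prod.remove mult_ac)
      then show ?thesis using g[OF True] is_ideal_mult_left[OF is_ideal_var_pow] by metis
    next
      case False
      then show ?thesis
        using that is_ideal_mult_left[OF is_ideal_var_pow] by (auto simp: X_def)
    qed
    then have "(\<Prod>C\<in>X. g C) \<in> P" using P_iff by blast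
    then show False using prime_ideal_prod[OF P, of X g] g by auto
  qed
  then obtain C where C: "mincover H C" "f \<notin> var_pow C k" "\<And>g. g * f \<in> var_pow C k \<Longrightarrow> g \<in> P"
    by blast
  have "P = var_pow C 1"
  proof (intro set_eqI iffI)
    fix g assume "g \<in> P"
    then have "f * g \<in> var_pow C k" using P_iff C(1) by (metis mult.commute)
    then show "g \<in> var_pow C 1" using var_pow_primary C(2) by blast
  next
    fix g :: "('v \<Rightarrow>\<^sub>0 nat) \<Rightarrow>\<^sub>0 'k" assume "g \<in> var_pow C 1"
    then have "g ^ k * f \<in> var_pow C k"
      using power_in_var_pow[of g C 1 k] is_ideal_mult_right[OF is_ideal_var_pow] by auto
    then show "g \<in> P" using C(3) prime_ideal_power[OF P] by blast
  qed
  then show ?thesis using C(1) by blast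
qed

lemma Ass_eq: "k \<ge> 1 \<Longrightarrow> Ass (ideal_pow J k) = Min_primes J"
  unfolding Min_primes_eq using Ass_subset var_pow_in_Ass by blast

lemma pow_1: "ideal_pow J (Suc 0) = J"
  using pow_eq[of "Suc 0"] J_eq by simp

lemma normally_torsion_free: "normally_torsion_free J"
  using Ass_eq Ass_eq[of "Suc 0", unfolded pow_1] by (simp add: normally_torsion_free_def)

lemma nearly_normally_torsion_free: "nearly_normally_torsion_free J"
  unfolding nearly_normally_torsion_free_def
  \<comment> \<open>The value \<open>k = 1\<close> suffices, as \<open>Ass_eq\<close> covers all
    positive powers.\<close>
  by (rule exI[of _ 1]) (auto simp: Ass_eq monomial_prime_def)

lemma persistence: "persistence J"
  by (simp add: persistence_def Ass_eq del: ideal_pow.simps)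

text \<open>The monomial of an edge private to a vertex of \<open>C\<close> raises the degree along
  \<open>C\<close> of every term by exactly one. Multiplying \<open>f\<close> by it therefore shows
  that \<open>f\<close> has order at least \<open>k\<close>.\<close>

lemma strong_persistence: "strong_persistence J"
  unfolding strong_persistence_def
proof (intro allI impI set_eqI iffI)
  fix k f assume "k \<ge> 1" and f: "f \<in> ideal_colon (ideal_pow J (k + 1)) J"
  have "f \<in> var_pow C k" if C: "mincover H C" for C
  proof -
    obtain i e where e: "i \<in> C" "e \<in> H" "e \<inter> C = {i}"
      using C mincover_ne[OF C] unfolding mincover_def by blast
    have "f * monom (indicator_exp e) \<in> var_pow C (k + 1)"
      using f edge_in_J[OF e(2)] C by (simp add: ideal_colon_def pow_eq del: ideal_pow.simps)
    then show ?thesis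
      using e by (auto simp: var_pow_def mon_ideal_def keys_mult_monom)
  qed
  then show "f \<in> ideal_pow J k" by (simp add: pow_eq)
next
  fix k f assume "f \<in> ideal_pow J k"
  then have "f * g \<in> ideal_pow J (k + 1)" if "g \<in> J" for g
    using that unfolding ideal_pow.simps ideal_prod_def Suc_eq_plus1[symmetric]
    by (intro subsetD[OF ideal_gen_superset]) blast
  then show "f \<in> ideal_colon (ideal_pow J (k + 1)) J" by (simp add: ideal_colon_def)
qed

text \<open>This bounds from below the order of the coefficients in an equation of integral
  dependence over the \<open>k\<close>-th power.\<close>

lemma ideal_pow_ideal_pow: "a \<in> ideal_pow (ideal_pow J k) i \<Longrightarrow> mincover H C \<Longrightarrow> a \<in> var_pow C (k * i)"
proof (induction i arbitrary: a)
  case (Suc i)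
  have "ideal_pow (ideal_pow J k) (Suc i) \<subseteq> var_pow C (k * Suc i)"
    unfolding ideal_pow.simps ideal_prod_def
  proof (rule ideal_gen_least[OF is_ideal_var_pow], safe)
    fix a b assume "a \<in> ideal_pow (ideal_pow J k) i" "b \<in> ideal_pow J k"
    then show "a * b \<in> var_pow C (k * Suc i)"
      using Suc mult_in_var_pow[of a C "k * i" b k] by (auto simp: pow_eq add.commute)
  qed
  then show ?case using Suc.prems by blast
qed simp

lemma normal_ideal: "normal_ideal J"
  unfolding normal_ideal_def
proof (intro allI impI set_eqI iffI)
  fix k f assume "k \<ge> 1" and "f \<in> integral_closure (ideal_pow J k)"
  then obtain m a where m: "m \<ge> 1" and a: "\<And>i. i \<in> {1..m} \<Longrightarrow> a i \<in> ideal_pow (ideal_pow J k) i"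
    and eq: "f ^ m + (\<Sum>i=1..m. a i * f ^ (m - i)) = 0"
    unfolding integral_closure_def by blast
  have "f \<in> var_pow C k" if C: "mincover H C" for C
  proof (rule ccontr)
    assume contra: "f \<notin> var_pow C k"
    \<comment> \<open>Here \<open>d\<close> is the exact order of \<open>f\<close> along
      \<open>C\<close>. Then \<open>f ^ m\<close> has order at most \<open>m * d\<close>, while
      every other term of the equation has larger order.\<close>
    then obtain d where d: "f \<notin> var_pow C (Suc d)" "f \<in> var_pow C d" "d < k"
      using ex_least_nat_less[of "\<lambda>d. f \<notin> var_pow C d" k] by auto
    have "a i * f ^ (m - i) \<in> var_pow C (Suc (m * d))" if i: "i \<in> {1..m}" for i
    proof -
      have "a i * f ^ (m - i) \<in> var_pow C (k * i + d * (m - i))"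
        using a[OF i] C d(2) by (intro mult_in_var_pow ideal_pow_ideal_pow power_in_var_pow)
      moreover have "Suc (m * d) \<le> k * i + d * (m - i)"
      proof -
        have "m * d = d * i + d * (m - i)"
          using i by (simp add: mult.commute flip: distrib_left)
        \<comment> \<open>The gain is strict because the index \<open>i\<close> is at least
          1.\<close>
        moreover have "d * i < k * i" using d(3) i by simp
        ultimately show ?thesis by linarith
      qed
      ultimately show ?thesis using var_pow_antimono by blast
    qed
    then have "- (\<Sum>i=1..m. a i * f ^ (m - i)) \<in> var_pow C (Suc (m * d))"
      by (intro is_ideal_uminus is_ideal_sum is_ideal_var_pow)
    then have "f ^ m \<in> var_pow C (Suc (m * d))"
      using eq by (simp add: eq_neg_iff_add_eq_0[symmetric])
    then show False using power_notin_var_pow[OF d(1)] by blast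
  qed
  then show "f \<in> ideal_pow J k" by (simp add: pow_eq)
next
  fix k f assume f: "f \<in> ideal_pow J k"
  \<comment> \<open>An element of the ideal satisfies the equation of degree one with coefficient
    \<open>- f\<close>.\<close>
  have "- f \<in> ideal_pow J k"
    using f is_ideal_uminus[OF is_ideal_var_pow] by (auto simp: pow_eq)
  then have "- f \<in> ideal_pow (ideal_pow J k) 1"
    unfolding One_nat_def ideal_pow.simps ideal_prod_def
    by (intro subsetD[OF ideal_gen_superset] CollectI exI[of _ 1] exI[of _ "- f"]) simp
  then show "f \<in> integral_closure (ideal_pow J k)"
    unfolding integral_closure_def by (intro CollectI exI[of _ 1] exI[of _ "\<lambda>_. - f"]) auto
qed

text \<open>The choice in \<open>symbolic_power\<close> is harmless only if every finite primary
  decomposition, redundant or not, gives the same result. The components dropped there can be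
  restored by a multiplier outside \<open>var_pow C 1\<close>, which is then cancelled because
  \<open>var_pow C k\<close> is primary.\<close>

lemma symbolic_power_eq:
  assumes k: "k \<ge> 1"
  shows "symbolic_power J k = ideal_pow J k"
proof -
  let ?dec = "\<lambda>Qs. finite Qs \<and> (\<forall>Q\<in>Qs. primary_ideal Q) \<and> ideal_pow J k = \<Inter>Qs"
  let ?Qs = "(\<lambda>C. var_pow C k) ` Collect (mincover H)"
  have ex: "?dec ?Qs"
    using primary_ideal_var_pow[OF k] by (auto simp: pow_eq)
  have uniq: "\<Inter>{Q\<in>Qs. ideal_radical Q \<in> Min_primes J} = ideal_pow J k" if Qs: "?dec Qs" for Qs
  proof
    show "ideal_pow J k \<subseteq> \<Inter>{Q\<in>Qs. ideal_radical Q \<in> Min_primes J}" using Qs by blast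
    show "\<Inter>{Q\<in>Qs. ideal_radical Q \<in> Min_primes J} \<subseteq> ideal_pow J k"
    proof
      fix f assume f: "f \<in> \<Inter>{Q\<in>Qs. ideal_radical Q \<in> Min_primes J}"
      have "f \<in> var_pow C k" if C: "mincover H C" for C
      proof -
        \<comment> \<open>Otherwise the radical of \<open>Q\<close> is a prime between
          \<open>J\<close> and the minimal prime \<open>var_pow C 1\<close>, hence equal to it,
          although it was assumed not to be minimal.\<close>
        have "\<exists>g. g \<in> Q \<and> g \<notin> var_pow C 1" if Q: "Q \<in> Qs" "ideal_radical Q \<notin> Min_primes J" for Q
        proof (rule ccontr)
          assume "\<not> ?thesis"
          then have QC: "ideal_radical Q \<subseteq> var_pow C 1"
            using prime_ideal_power[OF prime_ideal_var_pow] unfolding ideal_radical_def by blast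
          have "primary_ideal Q" using Q Qs by blast
          then have rad: "prime_ideal (ideal_radical Q)"
            using prime_ideal_radical by blast
          have "g ^ k \<in> ideal_pow J k" if "g \<in> J" for g
            using that power_in_var_pow[of g _ 1 k] J_subset_var_pow by (auto simp: pow_eq)
          then have "J \<subseteq> ideal_radical Q"
            using Q Qs unfolding ideal_radical_def by blast
          have CMin: "var_pow C 1 \<in> Min_primes J"
            using C Min_primes_eq by blast
          then have "ideal_radical Q = var_pow C 1"
            using rad QC \<open>J \<subseteq> ideal_radical Q\<close> by (simp add: Min_primes_def)
          then show False using Q(2) CMin by simp
        qed
        then obtain g where g: "\<And>Q. Q \<in> Qs \<Longrightarrow> ideal_radical Q \<notin> Min_primes J \<Longrightarrow>
            g Q \<in> Q \<and> g Q \<notin> var_pow C 1"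
          by metis
        define X where "X = {Q\<in>Qs. ideal_radical Q \<notin> Min_primes J}"
        have fin: "finite X" using Qs by (simp add: X_def)
        \<comment> \<open>This product multiplies \<open>f\<close> into all dropped components at
          once, and hence into the full power.\<close>
        have "(\<Prod>Q\<in>X. g Q) \<notin> var_pow C 1"
          using prime_ideal_prod[OF prime_ideal_var_pow fin, of g C] g by (auto simp: X_def)
        moreover have "f * (\<Prod>Q\<in>X. g Q) \<in> Q" if Q: "Q \<in> Qs" for Q
        proof (cases "Q \<in> X")
          case True
          then have "f * (\<Prod>Q\<in>X. g Q) = (f * (\<Prod>Q\<in>X-{Q}. g Q)) * g Q"
            using fin by (simp add: prod.remove mult_ac)
          moreover have "is_ideal Q" using Q Qs by (auto simp: primary_ideal_def)
          ultimately show ?thesis using g True is_ideal_mult_left by (auto simp: X_def)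
        next
          case False
          then have "f \<in> Q" using f Q by (auto simp: X_def)
          moreover have "is_ideal Q" using Q Qs by (auto simp: primary_ideal_def)
          ultimately show ?thesis using is_ideal_mult_right by blast
        qed
        then have "f * (\<Prod>Q\<in>X. g Q) \<in> ideal_pow J k"
          using Qs by blast
        then have "f * (\<Prod>Q\<in>X. g Q) \<in> var_pow C k"
          using C by (simp add: pow_eq)
        ultimately show ?thesis using var_pow_primary by blast
      qed
      then show "f \<in> ideal_pow J k" by (simp add: pow_eq)
    qed
  qed
  show ?thesis
    unfolding symbolic_power_def
  proof (rule some_equality)
    show "\<exists>Qs. finite Qs \<and> (\<forall>Q\<in>Qs. primary_ideal Q) \<and> ideal_pow J k = \<Inter>Qs \<and>
        ideal_pow J k = \<Inter>{Q\<in>Qs. ideal_radical Q \<in> Min_primes J}"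
      by (intro exI[of _ ?Qs] conjI ex[THEN conjunct1] ex[THEN conjunct2, THEN conjunct1]
          ex[THEN conjunct2, THEN conjunct2] uniq[OF ex, symmetric])
  next
    fix K
    assume "\<exists>Qs. finite Qs \<and> (\<forall>Q\<in>Qs. primary_ideal Q) \<and> ideal_pow J k = \<Inter>Qs \<and>
        K = \<Inter>{Q\<in>Qs. ideal_radical Q \<in> Min_primes J}"
    then obtain Qs where Qs: "?dec Qs" "K = \<Inter>{Q\<in>Qs. ideal_radical Q \<in> Min_primes J}"
      by blast
    show "K = ideal_pow J k"
      unfolding Qs(2) by (rule uniq[OF Qs(1)])
  qed
qed

lemma symbolic_strong_persistence: "symbolic_strong_persistence J"
  using strong_persistence
  by (simp add: symbolic_strong_persistence_def strong_persistence_def symbolic_power_eq pow_1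
      del: ideal_pow.simps)

end

section \<open>Squarefree monomial ideals that are normally torsion-free\<close>

text \<open>A packing of \<open>k\<close> edges uses each vertex at most \<open>k\<close> times, so
  adding weight where there is already \<open>k\<close> gains nothing. The induction removes one
  edge, which lowers each weight by at most one.\<close>

lemma exps_pow_cancel:
  fixes H :: "'v::finite set set"
  assumes "v + u \<in> exps_pow (edge_exps H) k" "\<And>i. i \<in> keys u \<Longrightarrow> k \<le> lookup v i"
  shows "v \<in> exps_pow (edge_exps H) k"
  using assms
proof (induction k arbitrary: v)
  case (Suc k)
  then obtain a b e where ab: "v + u = a + b" "a \<in> exps_pow (edge_exps H) k"
    and e: "e \<in> H" "e \<subseteq> keys b"
    by (auto simp: edge_exps_def)
  have "keys u \<subseteq> keys v"
  proof
    fix i assume "i \<in> keys u"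
    from Suc.prems(2)[OF this] show "i \<in> keys v" by (simp add: in_keys_iff)
  qed
  moreover have "e \<subseteq> keys v \<union> keys u"
    using e(2) ab(1) keys_plus_nat[of v u] keys_plus_nat[of a b] by auto
  ultimately have "e \<subseteq> keys v" by blast
  define v' where "v' = v - indicator_exp e"
  define b' where "b' = b - indicator_exp e"
  have v: "v = v' + indicator_exp e" and b: "b = b' + indicator_exp e"
    using minus_indicator_exp[OF \<open>e \<subseteq> keys v\<close>] minus_indicator_exp[OF e(2)]
    by (simp_all add: v'_def b'_def)
  have "(v' + u) + indicator_exp e = (a + b') + indicator_exp e"
    using ab(1) by (simp add: v b ac_simps)
  then have "v' + u = a + b'"
    by simp
  also have "\<dots> \<in> exps_pow (edge_exps H) k"
    using up_closed_exps_pow[OF up_closed_edge_exps] ab(2) by (auto simp: up_closed_def)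
  finally have "v' \<in> exps_pow (edge_exps H) k"
  proof (rule Suc.IH)
    fix i assume "i \<in> keys u"
    from Suc.prems(2)[OF this] show "k \<le> lookup v' i" by (auto simp: v'_def lookup_minus)
  qed
  moreover have "indicator_exp e \<in> edge_exps H"
    using e by (auto simp: edge_exps_def)
  ultimately show ?case
    using v by auto
qed simp

text \<open>This is localisation at \<open>var_pow D 1\<close>: variables outside \<open>D\<close>
  become units, the private edge of \<open>i\<close> becomes the variable \<open>i\<close> alone,
  and so the \<open>k\<close>-th power of the edge ideal becomes that of the prime.\<close>

lemma exps_pow_localize:
  fixes H :: "'v::finite set set"
  assumes D: "mincover H D" and "k \<le> deg_on D v"
  shows "\<exists>u. keys u \<inter> D = {} \<and> v + u \<in> exps_pow (edge_exps H) k"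
  using assms(2)
proof (induction k arbitrary: v)
  case 0
  show ?case by (rule exI[of _ 0]) simp
next
  case (Suc k)
  then have "1 \<le> deg_on D v" by simp
  then have "keys v \<inter> D \<noteq> {}" by (rule iffD1[OF deg_on_ge_1[OF finite]])
  then obtain i where i: "i \<in> keys v" "i \<in> D" by blast
  obtain e where e: "e \<in> H" "e \<inter> D = {i}" using D i by (auto simp: mincover_def)
  define v' where "v' = v - indicator_exp {i}"
  have v: "v = v' + indicator_exp {i}"
    using minus_indicator_exp[of "{i}" v] i by (simp add: v'_def)
  have "deg_on D v = deg_on D v' + 1"
    using i by (simp add: v)
  then have "k \<le> deg_on D v'" using Suc.prems by simp
  from Suc.IH[OF this] obtain u where u: "keys u \<inter> D = {}" "v' + u \<in> exps_pow (edge_exps H) k"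
    by blast
  \<comment> \<open>The rest of the private edge avoids \<open>D\<close> and may go into the
    multiplier \<open>u\<close>.\<close>
  have "indicator_exp e = indicator_exp {i} + indicator_exp (e - {i})"
    using e by (intro poly_mapping_eqI) (auto simp: lookup_add)
  then have "v + (u + indicator_exp (e - {i})) = (v' + u) + indicator_exp e"
    by (simp add: v ac_simps)
  moreover have "indicator_exp e \<in> edge_exps H"
    using e by (auto simp: edge_exps_def)
  moreover have "keys (u + indicator_exp (e - {i})) \<inter> D = {}"
    using u(1) e(2) by (auto simp: keys_plus_nat)
  ultimately show ?case using u(2) unfolding exps_pow.simps by blast
qed

text \<open>Some exponent \<open>a\<close> of \<open>f\<close> contains no edge, but does so once a
  vertex \<open>i\<close> of \<open>D\<close> is added. Since \<open>a\<close> avoids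
  \<open>D\<close>, that edge is private to \<open>i\<close>.\<close>

lemma mincover_of_Ass:
  fixes H :: "'v::finite set set"
  assumes "(var_pow D 1 :: (('v \<Rightarrow>\<^sub>0 nat) \<Rightarrow>\<^sub>0 'k::field) set) \<in> Ass (mon_ideal (edge_exps H))"
  shows "mincover H D"
proof -
  obtain f :: "('v \<Rightarrow>\<^sub>0 nat) \<Rightarrow>\<^sub>0 'k" where f: "var_pow D 1 = ideal_colon (mon_ideal (edge_exps H)) {f}"
    using assms by (auto simp: Ass_def)
  have f_iff: "g * f \<in> mon_ideal (edge_exps H) \<longleftrightarrow> g \<in> var_pow D 1" for g
    unfolding f by (simp add: ideal_colon_def)
  from f_iff[of 1] have "f \<notin> mon_ideal (edge_exps H)" by simp
  then obtain a where a: "a \<in> keys f" "a \<notin> edge_exps H" by (auto simp: mon_ideal_def)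
  have ex: "\<exists>e\<in>H. e \<subseteq> insert i (keys a)" if "i \<in> D" for i
  proof -
    have "f * var i \<in> mon_ideal (edge_exps H)"
      using f_iff[of "var i"] that by (simp add: mult.commute)
    then have "a + Poly_Mapping.single i 1 \<in> edge_exps H"
      using a(1) by (auto simp: mon_ideal_def var_def keys_mult_monom)
    then show ?thesis by (auto simp: edge_exps_def keys_plus_nat)
  qed
  have disj: "i \<notin> keys a" if "i \<in> D" for i
    using ex[OF that] a(2) by (auto simp: edge_exps_def insert_absorb)
  have "\<exists>e\<in>H. e \<inter> D = {i}" if i: "i \<in> D" for i
  proof -
    obtain e where e: "e \<in> H" "e \<subseteq> insert i (keys a)" using ex[OF i] by blast
    moreover have "\<not> e \<subseteq> keys a" using e(1) a(2) by (auto simp: edge_exps_def)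
    ultimately show ?thesis using disj i by (intro bexI[of _ e]) auto
  qed
  moreover have "cover H D"
    unfolding cover_def
  proof
    fix e assume "e \<in> H"
    then have "(monom (indicator_exp e) :: ('v \<Rightarrow>\<^sub>0 nat) \<Rightarrow>\<^sub>0 'k) \<in> mon_ideal (edge_exps H)"
      by (auto simp: edge_exps_def)
    then have "(monom (indicator_exp e) :: ('v \<Rightarrow>\<^sub>0 nat) \<Rightarrow>\<^sub>0 'k) \<in> var_pow D 1"
      using f_iff is_ideal_mult_right[OF is_ideal_mon_ideal[OF up_closed_edge_exps]] by metis
    then show "e \<inter> D \<noteq> {}" by auto
  qed
  ultimately show ?thesis by (simp add: mincover_def)
qed

text \<open>A symbolic exponent outside the ordinary power can be enlarged until its colon ideal is prime:
  maximise the exponents truncated at \<open>k\<close>, beyond which they no longer matter for \<open>I\<^sup>k\<close>.\<close>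
lemma mengerian_if_normally_torsion_free:
  fixes H :: "'v::finite set set"
  assumes ntf: "normally_torsion_free (mon_ideal (edge_exps H) :: (('v \<Rightarrow>\<^sub>0 nat) \<Rightarrow>\<^sub>0 'k::field) set)"
  shows "mengerian H"
  unfolding mengerian_def
proof (intro allI subsetI, rule ccontr)
  fix k w
  let ?E = "exps_pow (edge_exps H) k"
  let ?I = "mon_ideal (edge_exps H) :: (('v \<Rightarrow>\<^sub>0 nat) \<Rightarrow>\<^sub>0 'k) set"
  assume w: "w \<in> symb_exps H k" "w \<notin> ?E"
  define m :: "('v \<Rightarrow>\<^sub>0 nat) \<Rightarrow> nat" where "m v = (\<Sum>i\<in>UNIV. min k (lookup v i))" for v
  have bound: "m v < Suc (\<Sum>i\<in>(UNIV::'v set). k)" for v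
    unfolding m_def less_Suc_eq_le by (rule sum_mono) simp
  obtain v where v: "(\<exists>u. v = w + u) \<and> v \<notin> ?E"
    and max: "\<And>v'. (\<exists>u. v' = w + u) \<and> v' \<notin> ?E \<Longrightarrow> m v' \<le> m v"
    using ex_has_greatest_nat[of "\<lambda>v. (\<exists>u. v = w + u) \<and> v \<notin> ?E" w m] w(2) bound
    by (metis add.right_neutral)
  \<comment> \<open>On \<open>D\<close> any further weight would raise \<open>m\<close>, so by
    maximality it leads into the power. Off \<open>D\<close> extra weight has no effect by
    \<open>exps_pow_cancel\<close>. Hence the colon ideal of \<open>monom v\<close> is
    \<open>var_pow D 1\<close>.\<close>
  define D where "D = {i. lookup v i < k}"
  have single: "v + Poly_Mapping.single i 1 \<in> ?E" if i: "i \<in> D" for i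
  proof (rule ccontr)
    assume "v + Poly_Mapping.single i 1 \<notin> ?E"
    then have "m (v + Poly_Mapping.single i 1) \<le> m v"
      using v by (intro max) (auto simp: add.assoc)
    moreover have "m v < m (v + Poly_Mapping.single i 1)"
      unfolding m_def using i
      by (intro sum_strict_mono_ex1) (auto simp: lookup_add lookup_single when_def D_def intro!: bexI[of _ i])
    ultimately show False by simp
  qed
  have colon_iff: "a + v \<in> ?E \<longleftrightarrow> keys a \<inter> D \<noteq> {}" for a
  proof
    assume "a + v \<in> ?E"
    then show "keys a \<inter> D \<noteq> {}"
      using v exps_pow_cancel[of v a H k] by (force simp: D_def add.commute not_less)
  next
    assume "keys a \<inter> D \<noteq> {}"
    then obtain i where i: "i \<in> keys a" "i \<in> D" by blast
    have "indicator_exp {i} = Poly_Mapping.single i 1"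
      by (rule poly_mapping_eqI) (auto simp: lookup_single when_def)
    then have "a = (a - indicator_exp {i}) + Poly_Mapping.single i 1"
      using minus_indicator_exp[of "{i}" a] i by simp
    then have "a + v = (v + Poly_Mapping.single i 1) + (a - indicator_exp {i})"
      by (metis add.assoc add.commute)
    then show "a + v \<in> ?E"
      using single[OF i(2)] up_closed_exps_pow[OF up_closed_edge_exps] unfolding up_closed_def by metis
  qed
  have "ideal_colon (ideal_pow ?I k) {monom v} = var_pow D 1"
  proof (intro set_eqI)
    fix f :: "('v \<Rightarrow>\<^sub>0 nat) \<Rightarrow>\<^sub>0 'k"
    have "f \<in> ideal_colon (ideal_pow ?I k) {monom v} \<longleftrightarrow> (\<forall>a\<in>keys f. a + v \<in> ?E)"
      unfolding ideal_pow_mon_ideal[OF up_closed_edge_exps]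
      by (auto simp: ideal_colon_def mon_ideal_def keys_mult_monom)
    also have "\<dots> \<longleftrightarrow> f \<in> var_pow D 1"
      unfolding colon_iff var_pow_def mon_ideal_def using deg_on_ge_1[of D] by auto
    finally show "f \<in> ideal_colon (ideal_pow ?I k) {monom v} \<longleftrightarrow> f \<in> var_pow D 1" .
  qed
  then have "(var_pow D 1 :: (('v \<Rightarrow>\<^sub>0 nat) \<Rightarrow>\<^sub>0 'k) set) \<in> Ass (ideal_pow ?I k)"
    using prime_ideal_var_pow[of D] unfolding Ass_def by blast
  moreover have "k \<ge> 1" using w(2) by (cases k) auto
  ultimately have D: "mincover H D"
    using ntf mincover_of_Ass unfolding normally_torsion_free_def by blast
  \<comment> \<open>The symbolic bound on \<open>w\<close> passes to its multiple \<open>v\<close>.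
    Localising at \<open>D\<close> then gives a multiplier avoiding \<open>D\<close> that leads into
    the power, which the colon ideal forbids.\<close>
  then have "k \<le> deg_on D v"
    using w(1) v by (auto simp: symb_exps_def intro: trans_le_add1)
  then obtain u where "keys u \<inter> D = {}" "u + v \<in> ?E"
    using exps_pow_localize[OF D] by (metis add.commute)
  then show False using colon_iff by blast
qed

section \<open>Squarefree monomial ideals as edge ideals, and the gcd condition\<close>

lemma squarefree_exp_eq:
  fixes a :: "'v::finite \<Rightarrow>\<^sub>0 nat"
  assumes "squarefree_exp a"
  shows "a = indicator_exp (keys a)"
proof (rule poly_mapping_eqI)
  fix i
  have "lookup a i \<le> 1" using assms by (simp add: squarefree_exp_def)
  then show "lookup a i = lookup (indicator_exp (keys a)) i" by (auto simp: in_keys_iff)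
qed

lemma monom_dvd_iff:
  "(monom a :: ('v::finite \<Rightarrow>\<^sub>0 nat) \<Rightarrow>\<^sub>0 'k::field) dvd monom b \<longleftrightarrow> (\<exists>c. b = a + c)"
proof
  assume "(monom a :: ('v \<Rightarrow>\<^sub>0 nat) \<Rightarrow>\<^sub>0 'k) dvd monom b"
  then obtain f :: "('v \<Rightarrow>\<^sub>0 nat) \<Rightarrow>\<^sub>0 'k" where f: "monom b = f * monom a"
    by (auto simp: dvd_def mult.commute)
  have "keys (monom b :: ('v \<Rightarrow>\<^sub>0 nat) \<Rightarrow>\<^sub>0 'k) = {b}" by (simp add: monom_def)
  then show "\<exists>c. b = a + c"
    unfolding f keys_mult_monom by (auto simp: add.commute)
qed (auto simp: monom_mult[symmetric])

lemma var_dvd_monom_iff: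
  "(var i :: ('v::finite \<Rightarrow>\<^sub>0 nat) \<Rightarrow>\<^sub>0 'k::field) dvd monom a \<longleftrightarrow> i \<in> keys a"
proof
  assume "i \<in> keys a"
  then have "a = indicator_exp {i} + (a - indicator_exp {i})"
    using minus_indicator_exp[of "{i}" a] by (simp add: add.commute)
  moreover have "indicator_exp {i} = Poly_Mapping.single i 1"
    by (rule poly_mapping_eqI) (auto simp: lookup_single when_def)
  ultimately show "(var i :: ('v \<Rightarrow>\<^sub>0 nat) \<Rightarrow>\<^sub>0 'k) dvd monom a"
    unfolding var_def monom_dvd_iff by metis
qed (auto simp: var_def monom_dvd_iff keys_plus_nat)

text \<open>The edges must be the supports of the minimal generators, because the gcd condition
  speaks about these. The proof passes through the given squarefree generators \<open>S\<close>,
  whose exponent set \<open>A\<close> depends on supports only.\<close>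

lemma squarefree_monomial_ideal_edges:
  fixes I :: "(('v::finite \<Rightarrow>\<^sub>0 nat) \<Rightarrow>\<^sub>0 'k::field) set"
  assumes "squarefree_monomial_ideal I"
  shows "I = mon_ideal (edge_exps {keys a | a. (monom a :: ('v \<Rightarrow>\<^sub>0 nat) \<Rightarrow>\<^sub>0 'k) \<in> min_gens I})"
proof -
  obtain S where S: "S \<subseteq> {h. squarefree_monomial h}" "I = ideal_gen S"
    using assms by (auto simp: squarefree_monomial_ideal_def)
  define A where "A = edge_exps {keys a | a. squarefree_exp a \<and> (monom a :: ('v \<Rightarrow>\<^sub>0 nat) \<Rightarrow>\<^sub>0 'k) \<in> S}"
  have I: "I = mon_ideal A"
  proof
    show "I \<subseteq> mon_ideal A"
      unfolding S(2)
    proof (rule ideal_gen_least)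
      show "S \<subseteq> mon_ideal A"
        using S(1) by (fastforce simp: squarefree_monomial_def A_def edge_exps_def)
    qed (simp add: A_def is_ideal_mon_ideal[OF up_closed_edge_exps])
    show "mon_ideal A \<subseteq> I"
      unfolding S(2)
    proof (rule mon_ideal_subset_ideal[OF is_ideal_ideal_gen])
      fix b assume "b \<in> A"
      then obtain a where a: "squarefree_exp a" "monom a \<in> S" "keys a \<subseteq> keys b"
        by (auto simp: A_def edge_exps_def)
      have "monom (indicator_exp (keys a)) \<in> ideal_gen S"
        unfolding squarefree_exp_eq[OF a(1), symmetric] using a(2) ideal_gen_superset by blast
      then show "monom b \<in> ideal_gen S"
        using a(3) by (rule monom_in_ideal[OF is_ideal_ideal_gen])
    qed
  qed
  have "A = edge_exps {keys a | a. (monom a :: ('v \<Rightarrow>\<^sub>0 nat) \<Rightarrow>\<^sub>0 'k) \<in> min_gens I}"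
  proof (intro set_eqI iffI)
    fix b assume b: "b \<in> A"
    \<comment> \<open>Least total degree makes \<open>a\<close> minimal for divisibility.
      Containment of supports is enough here, since \<open>edge_exps\<close> does not see
      multiplicities.\<close>
    obtain a where a: "a \<in> A" "keys a \<subseteq> keys b"
      and least: "\<And>c. c \<in> A \<Longrightarrow> keys c \<subseteq> keys b \<Longrightarrow> deg_on UNIV a \<le> deg_on UNIV c"
      using ex_has_least_nat[of "\<lambda>a. a \<in> A \<and> keys a \<subseteq> keys b" b "deg_on UNIV"] b by blast
    have "c = a" if "c \<in> A" "a = c + d" for c d
    proof -
      have "deg_on UNIV a \<le> deg_on UNIV c"
        using that a(2) by (intro least) (auto simp: keys_plus_nat)
      then have "deg_on UNIV d = 0" using that(2) by simp
      then have "d = 0" by (intro poly_mapping_eqI) (simp add: deg_on_def)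
      then show ?thesis using that(2) by simp
    qed
    then have "(monom a :: ('v \<Rightarrow>\<^sub>0 nat) \<Rightarrow>\<^sub>0 'k) \<in> min_gens I"
      using a(1) by (auto simp: min_gens_def I monom_dvd_iff)
    then show "b \<in> edge_exps {keys a | a. (monom a :: ('v \<Rightarrow>\<^sub>0 nat) \<Rightarrow>\<^sub>0 'k) \<in> min_gens I}"
      using a(2) by (auto simp: edge_exps_def)
  next
    fix b assume "b \<in> edge_exps {keys a | a. (monom a :: ('v \<Rightarrow>\<^sub>0 nat) \<Rightarrow>\<^sub>0 'k) \<in> min_gens I}"
    then obtain a where a: "(monom a :: ('v \<Rightarrow>\<^sub>0 nat) \<Rightarrow>\<^sub>0 'k) \<in> min_gens I" "keys a \<subseteq> keys b"
      by (auto simp: edge_exps_def)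
    then have "(monom a :: ('v \<Rightarrow>\<^sub>0 nat) \<Rightarrow>\<^sub>0 'k) \<in> I" by (auto simp: min_gens_def)
    then have "a \<in> A" by (simp add: I)
    then show "b \<in> A" using a(2) unfolding A_def edge_exps_def by blast
  qed
  then show ?thesis using I by simp
qed

lemma ideal_sum_edge:
  fixes H :: "'v::finite set set"
  shows "ideal_sum (mon_ideal (edge_exps H)) (ideal_gen {monom (indicator_exp e)}) =
    (mon_ideal (edge_exps (insert e H)) :: (('v \<Rightarrow>\<^sub>0 nat) \<Rightarrow>\<^sub>0 'k::field) set)"
    (is "?L = ?R")
proof
  show "?L \<subseteq> ?R"
    unfolding ideal_sum_def
  proof (intro ideal_gen_least Un_least is_ideal_mon_ideal up_closed_edge_exps)
    show "{monom (indicator_exp e)} \<subseteq> ?R" by (auto simp: edge_exps_def)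
  qed (auto simp: mon_ideal_def edge_exps_def)
  have L: "is_ideal ?L" "mon_ideal (edge_exps H) \<subseteq> ?L" "monom (indicator_exp e) \<in> ?L"
    using ideal_gen_superset[of "mon_ideal (edge_exps H) \<union> ideal_gen {monom (indicator_exp e)}"]
      ideal_gen_superset[of "{monom (indicator_exp e)}"]
    by (auto simp: ideal_sum_def is_ideal_ideal_gen)
  show "?R \<subseteq> ?L"
  proof (rule mon_ideal_subset_ideal[OF L(1)])
    fix a assume "a \<in> edge_exps (insert e H)"
    then consider "e \<subseteq> keys a" | "a \<in> edge_exps H" by (auto simp: edge_exps_def)
    then show "monom a \<in> ?L"
    proof cases
      case 1
      then show ?thesis by (rule monom_in_ideal[OF L(1,3)])
    next
      case 2
      then show ?thesis using L(2) by (meson monom_in_mon_ideal subsetD)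
    qed
  qed
qed

text \<open>The support of a monomial consists of the variables dividing it, and a variable divides
  a gcd iff it divides both arguments.\<close>

lemma is_gcd_monom_keys:
  fixes a c d :: "'v::finite \<Rightarrow>\<^sub>0 nat"
  assumes "is_gcd (monom d) (monom c) (monom a :: ('v \<Rightarrow>\<^sub>0 nat) \<Rightarrow>\<^sub>0 'k::field)"
  shows "keys a \<inter> keys c = keys d"
proof (intro set_eqI)
  fix i
  have "(var i :: ('v \<Rightarrow>\<^sub>0 nat) \<Rightarrow>\<^sub>0 'k) dvd monom d \<longleftrightarrow>
      (var i :: ('v \<Rightarrow>\<^sub>0 nat) \<Rightarrow>\<^sub>0 'k) dvd monom c \<and> (var i :: ('v \<Rightarrow>\<^sub>0 nat) \<Rightarrow>\<^sub>0 'k) dvd monom a"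
    using assms unfolding is_gcd_def by (meson dvd_trans)
  then show "i \<in> keys a \<inter> keys c \<longleftrightarrow> i \<in> keys d"
    unfolding var_dvd_monom_iff by blast
qed

text \<open>Old edges through \<open>s\<close> all pass through \<open>r\<close>, so a minimal cover never needs both.\<close>
lemma mengerian_insert_chain:
  fixes H :: "'v::finite set set"
  assumes H: "mengerian H"
    and chain: "\<And>e. e \<in> H \<Longrightarrow> e \<inter> h = {} \<or> e \<inter> h = {r} \<or> e \<inter> h = {r, s}"
  shows "mengerian (insert h H)"
proof (rule mengerian_insert[OF H], rule ccontr)
  fix C i j
  assume C: "mincover (insert h H) C" and ij: "i \<in> C \<inter> h" "j \<in> C \<inter> h" "i \<noteq> j"
  \<comment> \<open>The private edge of \<open>x\<close> is an old one, because \<open>h\<close>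
    also meets \<open>C\<close> in \<open>y\<close>.\<close>
  have ex: "\<exists>e\<in>H. e \<inter> C = {x}" if x: "x \<in> C" "y \<in> C \<inter> h" "x \<noteq> y" for x y
  proof -
    obtain e where e: "e \<in> insert h H" "e \<inter> C = {x}"
      using C x(1) unfolding mincover_def by blast
    moreover have "e \<noteq> h"
    proof
      assume "e = h"
      then have "y \<in> e \<inter> C" using x(2) by simp
      then show False using e(2) x(3) by simp
    qed
    ultimately show ?thesis by blast
  qed
  obtain e where e: "e \<in> H" "e \<inter> C = {i}" using ex[of i j] ij by blast
  obtain e' where e': "e' \<in> H" "e' \<inter> C = {j}" using ex[of j i] ij by blast
  have mem: "i \<in> e \<inter> h" "j \<notin> e" "j \<in> e' \<inter> h" "i \<notin> e'"
    using e(2) e'(2) ij by auto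
  \<comment> \<open>Both private edges meet \<open>h\<close> and so contain \<open>r\<close>. One of
    \<open>i\<close> and \<open>j\<close> is \<open>r\<close>, which contradicts its absence from
    the private edge of the other.\<close>
  then have "r \<in> e" "r \<in> e'" "i \<in> {r, s}" "j \<in> {r, s}"
    using chain[OF e(1)] chain[OF e'(1)] by auto
  then show False using mem ij(3) by auto
qed

theorem theorem2p3:
  fixes I :: "(('v::finite \<Rightarrow>\<^sub>0 nat) \<Rightarrow>\<^sub>0 'k::field) set"
    and h :: "('v \<Rightarrow>\<^sub>0 nat) \<Rightarrow>\<^sub>0 'k"
    and r s :: 'v
  assumes "squarefree_monomial_ideal I"
    and "normally_torsion_free I"
    and "squarefree_monomial h"
    and "r \<noteq> s"
    and "\<forall>u\<in>min_gens I. is_gcd 1 h u \<or> is_gcd (var r) h u \<or> is_gcd (var r * var s) h u"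
  shows "normally_torsion_free (ideal_sum I (ideal_gen {h})) \<and>
         nearly_normally_torsion_free (ideal_sum I (ideal_gen {h})) \<and>
         normal_ideal (ideal_sum I (ideal_gen {h})) \<and>
         strong_persistence (ideal_sum I (ideal_gen {h})) \<and>
         persistence (ideal_sum I (ideal_gen {h})) \<and>
         symbolic_strong_persistence (ideal_sum I (ideal_gen {h}))"
proof -
  define H where "H = {keys a | a. (monom a :: ('v \<Rightarrow>\<^sub>0 nat) \<Rightarrow>\<^sub>0 'k) \<in> min_gens I}"
  have I: "I = mon_ideal (edge_exps H)"
    unfolding H_def by (rule squarefree_monomial_ideal_edges[OF assms(1)])
  obtain c where c: "squarefree_exp c" and h: "h = monom c"
    using assms(3) by (auto simp: squarefree_monomial_def)
  have J: "ideal_sum I (ideal_gen {h}) = mon_ideal (edge_exps (insert (keys c) H))"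
    unfolding I h using ideal_sum_edge[of H "keys c"] by (simp only: squarefree_exp_eq[OF c, symmetric])
  have gens: "(1 :: ('v \<Rightarrow>\<^sub>0 nat) \<Rightarrow>\<^sub>0 'k) = monom 0"
    "(var r :: ('v \<Rightarrow>\<^sub>0 nat) \<Rightarrow>\<^sub>0 'k) = monom (Poly_Mapping.single r 1)"
    "(var r * var s :: ('v \<Rightarrow>\<^sub>0 nat) \<Rightarrow>\<^sub>0 'k) = monom (Poly_Mapping.single r 1 + Poly_Mapping.single s 1)"
    by (simp_all add: monom_def var_def mult_single)
  have "e \<inter> keys c = {} \<or> e \<inter> keys c = {r} \<or> e \<inter> keys c = {r, s}" if "e \<in> H" for e
  proof -
    obtain a where a: "e = keys a" "(monom a :: ('v \<Rightarrow>\<^sub>0 nat) \<Rightarrow>\<^sub>0 'k) \<in> min_gens I"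
      using \<open>e \<in> H\<close> by (auto simp: H_def)
    from assms(5) a(2) have "is_gcd 1 h (monom a) \<or> is_gcd (var r) h (monom a) \<or>
        is_gcd (var r * var s) h (monom a)"
      by blast
    then have "e \<inter> keys c = keys (0 :: 'v \<Rightarrow>\<^sub>0 nat) \<or>
        e \<inter> keys c = keys (Poly_Mapping.single r (1::nat)) \<or>
        e \<inter> keys c = keys (Poly_Mapping.single r (1::nat) + Poly_Mapping.single s 1)"
      unfolding gens(3) unfolding gens(1,2) h a(1) using is_gcd_monom_keys by blast
    then show ?thesis
      by (simp add: keys_plus_nat insert_commute)
  qed
  then have "mengerian (insert (keys c) H)"
    by (rule mengerian_insert_chain[OF mengerian_if_normally_torsion_free[OF assms(2)[unfolded I]]])
  \<comment> \<open>The new edge \<open>keys c\<close> makes the hypergraph nonempty even if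
    \<open>I\<close> is the zero ideal.\<close>
  then interpret mengerian_ideal "insert (keys c) H" "ideal_sum I (ideal_gen {h})"
    by unfold_locales (simp_all add: J)
  show ?thesis
    by (intro conjI normally_torsion_free nearly_normally_torsion_free normal_ideal
        strong_persistence persistence symbolic_strong_persistence)
qed

end
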